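(* Let $m\ge1$ and consider the system $$v_t(t,x)-\Lambda v_x(t,x)=\Sigma v(t,x),\qquad t\ge0,\ x\in(0,1),$$ with boundary condition $v(t,1)=U(t)$, initial condition $v_0\in(L^2(0,1))^m$, and feedback control law $U=(U_1,\dots,U_m)^T$, $$U_i(t)=\Phi_i\Big(t+\frac1{\mu_i}\Big)+\sum_{j=1}^m\int_0^1L_{ij}(1,\xi)v_j(t,\xi)\,d\xi-\sum_{j=1}^{i-1}\int_0^1\frac{\mu_j}{\mu_i}L_{ij}(\xi,0)\,\Phi_j\Big(t+\frac{1-\xi}{\mu_i}\Big)d\xi,$$ for $i=1,\dots,m$, where $\Phi=(\Phi_1,\dots,\Phi_m)^T$ is a given known function of time and $L=(L_{ij})_{1\le i,j\le m}$ is the solution of the kernel equations given in the context. Then $v(t,0)=\Phi(t)$ for (almost every) $t\ge t_M$, where $t_M=\sum_{j=1}^m\frac1{\mu_j}$.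
   Context: Setting. $v=(v_1,\dots,v_m)^T$, $\Lambda=\mathrm{diag}(\mu_1,\dots,\mu_m)$ with $\mu_1>\mu_2>\dots>\mu_m>0$, and $\Sigma=(\sigma_{ij})\in\mathbb R^{m\times m}$ is a constant matrix. Standing assumption: $\sigma_{jj}=0$ for $j=1,\dots,m$. The reference $\Phi:[0,\infty)\to\mathbb R^m$ is, e.g., in $L^2_{loc}$. Solutions are understood in the usual weak sense (integration along characteristics). Kernels. On $\mathcal T=\{(x,\xi):0\le\xi\le x\le1\}$, $L_{ij}$ ($1\le i,j\le m$) solve $\mu_i\partial_xL_{ij}+\mu_j\partial_\xi L_{ij}=\sum_{p=1}^m\sigma_{pj}L_{ip}$, with $L_{ij}(x,x)=l_{ij}:=-\frac{\sigma_{ij}}{\mu_i-\mu_j}$ for $i\ne j$; $L_{ij}(x,0)=0$ for $1\le i\le j\le m$; $L_{ij}(1,\xi)=l_{ij}$ for $1\le j<i\le m$. This system has a unique solution in $L^\infty(\mathcal T)$ (in the sense of integration along characteristics, each component being integrated from the part of $\partial\mathcal T$ where its boundary value is prescribed), with boundary traces in $L^\infty(0,1)$. *)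

theory Defs
  imports "HOL-Analysis.Analysis"
begin

definition L2_on :: "'a::euclidean_space set \<Rightarrow> ('a \<Rightarrow> real) \<Rightarrow> bool" where
  "L2_on S f \<longleftrightarrow>
     set_borel_measurable lborel S f \<and> set_integrable lborel S (\<lambda>x. (f x)\<^sup>2)"

definition Linf_on :: "'a::euclidean_space set \<Rightarrow> ('a \<Rightarrow> real) \<Rightarrow> bool" where
  "Linf_on S f \<longleftrightarrow>
     set_borel_measurable lborel S f \<and> (\<exists>C. AE x in lborel. x \<in> S \<longrightarrow> \<bar>f x\<bar> \<le> C)"

(* Integration along one characteristic: f solves (d . grad) f = g inside D on the half-line
   that leaves P in direction d, with value w at P. It is used for convex D and P in D, so
   that P + s d in D already puts the whole segment from P to P + s d into D. *)
definition solves_along ::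
  "'a::real_vector set \<Rightarrow> 'a \<Rightarrow> ('a \<Rightarrow> real) \<Rightarrow> ('a \<Rightarrow> real) \<Rightarrow> 'a \<Rightarrow> real \<Rightarrow> bool" where
  "solves_along D d f g P w \<longleftrightarrow>
     (\<forall>s\<ge>0. P + s *\<^sub>R d \<in> D \<longrightarrow>
        set_integrable lborel {0..s} (\<lambda>r. g (P + r *\<^sub>R d)) \<and>
        f (P + s *\<^sub>R d) = w + (LBINT r:{0..s}. g (P + r *\<^sub>R d)))"

(* Indices run over {1..m}. Points of the space-time strip are written (t, x).

   The functions are pointwise representatives for which the integrated equation holds on
   almost every characteristic, at all of its points, the end points on the boundary
   included. The characteristics of component i start at (0, y) and (\<tau>, 1) and leave
   through x = 0, so v i (t, 0) is, for almost every t, the trace at x = 0. *)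
definition weak_solution ::
  "nat \<Rightarrow> (nat \<Rightarrow> real) \<Rightarrow> (nat \<Rightarrow> nat \<Rightarrow> real) \<Rightarrow> (nat \<Rightarrow> real \<Rightarrow> real) \<Rightarrow>
   (nat \<Rightarrow> real \<Rightarrow> real) \<Rightarrow> (nat \<Rightarrow> real \<times> real \<Rightarrow> real) \<Rightarrow> bool" where
  "weak_solution m \<mu> \<sigma> v0 U v \<longleftrightarrow>
     (\<forall>i\<in>{1..m}.
        (\<forall>T\<ge>0. L2_on ({0..T} \<times> {0..1}) (v i)) \<and>
        (AE y in lborel. 0 < y \<and> y < 1 \<longrightarrow>
           solves_along ({0..} \<times> {0..1}) (1, - \<mu> i) (v i)
             (\<lambda>p. \<Sum>j=1..m. \<sigma> i j * v j p) (0, y) (v0 i y)) \<and>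
        (AE \<tau> in lborel. 0 < \<tau> \<longrightarrow>
           solves_along ({0..} \<times> {0..1}) (1, - \<mu> i) (v i)
             (\<lambda>p. \<Sum>j=1..m. \<sigma> i j * v j p) (\<tau>, 1) (U i \<tau>)))"

definition triangle :: "(real \<times> real) set" where
  "triangle = {(x, \<xi>). 0 \<le> \<xi> \<and> \<xi> \<le> x \<and> x \<le> 1}"

definition kernel_diag :: "(nat \<Rightarrow> real) \<Rightarrow> (nat \<Rightarrow> nat \<Rightarrow> real) \<Rightarrow> nat \<Rightarrow> nat \<Rightarrow> real" where
  "kernel_diag \<mu> \<sigma> i j = - (\<sigma> i j / (\<mu> i - \<mu> j))"

(* Each component is integrated from the part of the boundary where its value is prescribed:
   for i <= j in direction (\<mu> i, \<mu> j), starting on \<xi> = 0 and (if i < j) on the diagonal;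
   for j < i in the opposite direction, hence with the source negated, starting on the
   diagonal and on x = 1. As for weak_solution, the values of L i j on the sides \<xi> = 0 and
   x = 1 are then the traces, up to null sets of the sides. *)
definition kernel_solution ::
  "nat \<Rightarrow> (nat \<Rightarrow> real) \<Rightarrow> (nat \<Rightarrow> nat \<Rightarrow> real) \<Rightarrow>
   (nat \<Rightarrow> nat \<Rightarrow> real \<times> real \<Rightarrow> real) \<Rightarrow> bool" where
  "kernel_solution m \<mu> \<sigma> L \<longleftrightarrow>
     (\<forall>i\<in>{1..m}. \<forall>j\<in>{1..m}.
        Linf_on triangle (L i j) \<and>
        Linf_on {0..1} (\<lambda>x. L i j (x, 0)) \<and>
        Linf_on {0..1} (\<lambda>\<xi>. L i j (1, \<xi>)) \<and>
        (i < j \<longrightarrow>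
          (AE y in lborel. 0 < y \<and> y < 1 \<longrightarrow>
             solves_along triangle (\<mu> i, \<mu> j) (L i j)
               (\<lambda>p. \<Sum>k=1..m. \<sigma> k j * L i k p) (y, y) (kernel_diag \<mu> \<sigma> i j))) \<and>
        (i \<le> j \<longrightarrow>
          (AE y in lborel. 0 < y \<and> y < 1 \<longrightarrow>
             solves_along triangle (\<mu> i, \<mu> j) (L i j)
               (\<lambda>p. \<Sum>k=1..m. \<sigma> k j * L i k p) (y, 0) 0)) \<and>
        (j < i \<longrightarrow>
          (AE y in lborel. 0 < y \<and> y < 1 \<longrightarrow>
             solves_along triangle (- \<mu> i, - \<mu> j) (L i j)
               (\<lambda>p. - (\<Sum>k=1..m. \<sigma> k j * L i k p)) (y, y) (kernel_diag \<mu> \<sigma> i j)) \<and>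
          (AE y in lborel. 0 < y \<and> y < 1 \<longrightarrow>
             solves_along triangle (- \<mu> i, - \<mu> j) (L i j)
               (\<lambda>p. - (\<Sum>k=1..m. \<sigma> k j * L i k p)) (1, y) (kernel_diag \<mu> \<sigma> i j))))"

end

(* Fix a component i and a time t, and follow the characteristic of v i from (t, 1) down to
   (t + 1/mu_i, 0). Replacing time by the position x reached on it, V j (x, xi) =
   v j (t + (1 - x)/mu_i, xi) lives on the triangle of the kernel, and v j has its
   characteristics in the same direction (mu_i, mu_j) as L i j. The derivatives of the products
   L i j * V j along these directions cancel when summed over j, so the total flux of
   (mu_i, mu_j) * L i j * V j through the boundary of the triangle vanishes. The side x = 1 gives the
   feedback integral, the diagonal gives the source integrated along the characteristic of
   v i, and the side xi = 0 gives the integrals of L i j (x, 0) v j (., 0), j < i. If v j (., 0)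
   already equals Phi j for j < i, the control law turns this balance into
   v i (t + 1/mu_i, 0) = Phi i (t + 1/mu_i), and induction on i adds up the transport times. *)

theory Submission
  imports Defs
begin

text \<open>\<open>L\<close> is merely bounded and \<open>v\<close> merely square integrable, so
  each product \<open>L i j * V i t j\<close> can be differentiated only along its own direction
  \<open>(\<mu> i, \<mu> j)\<close>. These directions change with \<open>j\<close>. Hence every
  \<open>j\<close> gets its own divergence theorem, by Fubini over parallel lines, and the sources
  cancel only once all of them are area integrals over the same triangle. Null sets shape the rest.
  The equations hold on almost every characteristic, and a characteristic can be labelled by its
  starting point, by its exit time or by its intercept with \<xi> = 0. Passing between labels is
  affine with nonzero slope, so null sets are preserved. For the flux identity along lines this even
  works with \<open>t\<close> fixed; exceptional \<open>t\<close> come from the sections of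
  \<open>v\<close>, the control law and the characteristic of \<open>v i\<close> itself. The trace
  \<open>v j (_, 0)\<close> is not assumed integrable. The flux identity therefore accepts any
  integrable function that agrees almost everywhere with the trace of the product: one built from
  \<open>\<Phi> j\<close> if \<open>j < i\<close>, and zero if \<open>i \<le> j\<close>.\<close>

section \<open>Affine changes of variables\<close>

text \<open>The first argument selects a line of direction \<open>(\<alpha>, \<beta>)\<close>, the
  second is the parameter on it. The same family of maps yields slanted sections of the space-time
  strip (\<open>\<beta> = 1\<close>) and the change from position to time
  (\<open>\<alpha> = 0\<close>).\<close>

definition shear_map :: "real \<Rightarrow> real \<Rightarrow> real \<Rightarrow> real \<Rightarrow> real \<Rightarrow> real \<times> real \<Rightarrow> real \<times> real" where
  "shear_map a \<alpha> c \<beta> d = (\<lambda>(x, y). (c + \<alpha> * y + a * x, d + \<beta> * y))"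

lemma shear_map_measurable [measurable]: "shear_map a \<alpha> c \<beta> d \<in> borel \<rightarrow>\<^sub>M borel"
  unfolding shear_map_def by (simp add: borel_prod[symmetric])

text \<open>The map is triangular: for fixed \<open>y\<close> it is affine in \<open>x\<close>.
  Tonelli and two one-dimensional substitutions produce the determinant
  \<open>a * \<beta>\<close>.\<close>

lemma lborel_shear:
  assumes "a \<noteq> 0" "\<beta> \<noteq> 0"
  shows "lborel = density (distr lborel borel (shear_map a \<alpha> c \<beta> d)) (\<lambda>_. ennreal \<bar>a * \<beta>\<bar>)"
proof (rule measure_eqI)
  fix A :: "(real \<times> real) set" assume "A \<in> sets lborel"
  then have [measurable]: "A \<in> sets borel" by simp
  have [measurable]: "(indicator A :: _ \<Rightarrow> ennreal) \<in> borel_measurable (borel \<Otimes>\<^sub>M borel)"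
    by (simp add: borel_prod)
  define g where "g = (\<lambda>y. \<integral>\<^sup>+x. indicator A (x, y) \<partial>lborel)"
  have [measurable]: "(\<lambda>y. \<integral>\<^sup>+x. indicator A (x, y) \<partial>lborel :: ennreal) \<in> borel_measurable borel"
    by measurable
  then have gm [measurable]: "g \<in> borel_measurable borel" by (simp add: g_def)
  have "emeasure lborel A = (\<integral>\<^sup>+p. indicator A p \<partial>(lborel \<Otimes>\<^sub>M lborel))"
    by (simp add: lborel_prod)
  also have "\<dots> = (\<integral>\<^sup>+y. g y \<partial>lborel)"
    unfolding g_def by (rule lborel_pair.nn_integral_snd[symmetric]) (simp add: lborel_prod)
  also have "\<dots> = \<bar>\<beta>\<bar> * (\<integral>\<^sup>+y. g (d + \<beta> * y) \<partial>lborel)"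
    by (rule nn_integral_real_affine) (use assms in auto)
  also have "(\<lambda>y. g (d + \<beta> * y)) = (\<lambda>y. \<bar>a\<bar> * (\<integral>\<^sup>+x. indicator A (c + \<alpha> * y + a * x, d + \<beta> * y) \<partial>lborel))"
    unfolding g_def
    by (rule ext, rule nn_integral_real_affine) (use assms in measurable)
  also have "(\<integral>\<^sup>+y. \<bar>a\<bar> * (\<integral>\<^sup>+x. indicator A (c + \<alpha> * y + a * x, d + \<beta> * y) \<partial>lborel) \<partial>lborel)
     = \<bar>a\<bar> * (\<integral>\<^sup>+y. \<integral>\<^sup>+x. indicator A (c + \<alpha> * y + a * x, d + \<beta> * y) \<partial>lborel \<partial>lborel)"
    by (rule nn_integral_cmult) measurable
  also have "(\<integral>\<^sup>+y. \<integral>\<^sup>+x. indicator A (c + \<alpha> * y + a * x, d + \<beta> * y) \<partial>lborel \<partial>lborel)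
     = (\<integral>\<^sup>+y. \<integral>\<^sup>+x. indicator A (shear_map a \<alpha> c \<beta> d (x, y)) \<partial>lborel \<partial>lborel)"
    by (simp add: shear_map_def)
  also have "\<dots> = (\<integral>\<^sup>+p. indicator A (shear_map a \<alpha> c \<beta> d p) \<partial>(lborel \<Otimes>\<^sub>M lborel))"
    by (rule lborel_pair.nn_integral_snd) (simp add: lborel_prod)
  finally have "emeasure lborel A
     = \<bar>\<beta>\<bar> * (\<bar>a\<bar> * (\<integral>\<^sup>+p. indicator A (shear_map a \<alpha> c \<beta> d p) \<partial>lborel))"
    by (simp add: lborel_prod)
  moreover have "emeasure (distr lborel borel (shear_map a \<alpha> c \<beta> d)) A
      = (\<integral>\<^sup>+p. indicator A (shear_map a \<alpha> c \<beta> d p) \<partial>lborel)"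
  proof -
    have "(\<integral>\<^sup>+p. indicator A (shear_map a \<alpha> c \<beta> d p) \<partial>lborel)
        = integral\<^sup>N (distr lborel borel (shear_map a \<alpha> c \<beta> d)) (indicator A)"
      by (rule nn_integral_distr[symmetric]) simp_all
    then show ?thesis by simp
  qed
  ultimately show "emeasure lborel A
      = emeasure (density (distr lborel borel (shear_map a \<alpha> c \<beta> d)) (\<lambda>_. ennreal \<bar>a * \<beta>\<bar>)) A"
    by (simp add: emeasure_density nn_integral_cmult abs_mult ennreal_mult mult_ac)
qed simp

lemma
  fixes f :: "real \<times> real \<Rightarrow> real"
  assumes "a \<noteq> 0" "\<beta> \<noteq> 0" "integrable lborel f"
  shows integrable_shear: "integrable lborel (\<lambda>p. f (shear_map a \<alpha> c \<beta> d p))"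
    and integral_shear:
      "integral\<^sup>L lborel f = \<bar>a * \<beta>\<bar> * (\<integral>p. f (shear_map a \<alpha> c \<beta> d p) \<partial>lborel)"
proof -
  have [measurable]: "f \<in> borel_measurable borel"
    using assms(3) by (simp add: integrable_iff_bounded)
  have "integrable (density (distr lborel borel (shear_map a \<alpha> c \<beta> d)) (\<lambda>_. ennreal \<bar>a * \<beta>\<bar>)) f"
    using assms lborel_shear[of a \<beta> \<alpha> c d] by simp
  then show "integrable lborel (\<lambda>p. f (shear_map a \<alpha> c \<beta> d p))"
    using assms by (simp add: integrable_density integrable_distr_eq)
  have "integral\<^sup>L lborel f
      = integral\<^sup>L (density (distr lborel borel (shear_map a \<alpha> c \<beta> d)) (\<lambda>_. ennreal \<bar>a * \<beta>\<bar>)) f"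
    using assms lborel_shear[of a \<beta> \<alpha> c d] by simp
  also have "\<dots> = \<bar>a * \<beta>\<bar> * (\<integral>p. f (shear_map a \<alpha> c \<beta> d p) \<partial>lborel)"
    by (simp add: integral_density integral_distr)
  finally show "integral\<^sup>L lborel f = \<bar>a * \<beta>\<bar> * (\<integral>p. f (shear_map a \<alpha> c \<beta> d p) \<partial>lborel)" .
qed

text \<open>Moves the null set of bad characteristics from one labelling of the lines to
  another.\<close>

lemma AE_lborel_real_affine:
  fixes c t :: real
  assumes "AE x in lborel. P x" "c \<noteq> 0"
  shows "AE x in lborel. P (t + c * x)"
proof -
  from assms(1) obtain N where N: "{x. \<not> P x} \<subseteq> N" "emeasure lborel N = 0" "N \<in> sets lborel"
    by (auto elim: AE_E)
  have [measurable]: "N \<in> sets borel" using N by simp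
  have "AE x in lborel. x \<notin> N"
    using N by (intro AE_not_in) (auto simp: null_sets_def)
  then have "AE x in density (distr lborel borel (\<lambda>x. t + c * x)) (\<lambda>_. ennreal \<bar>c\<bar>). x \<notin> N"
    using lborel_real_affine[OF assms(2), of t] by metis
  then have "AE x in lborel. t + c * x \<notin> N"
    using assms(2) by (simp add: AE_density AE_distr_iff)
  then show ?thesis
    using N(1) by (auto elim!: eventually_mono)
qed

lemma set_lborel_real_affine:
  fixes f :: "real \<Rightarrow> real"
  assumes "c \<noteq> 0" "\<And>x. t + c * x \<in> A \<longleftrightarrow> x \<in> B"
  shows "(LBINT x:A. f x) = \<bar>c\<bar> * (LBINT x:B. f (t + c * x))"
    and "set_integrable lborel A f \<longleftrightarrow> set_integrable lborel B (\<lambda>x. f (t + c * x))"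
proof -
  have eq: "indicator A (t + c * x) = (indicator B x :: real)" for x
    using assms(2) by (simp add: indicator_def)
  show "(LBINT x:A. f x) = \<bar>c\<bar> * (LBINT x:B. f (t + c * x))"
    unfolding set_lebesgue_integral_def using assms(1)
    by (subst lborel_integral_real_affine[of c _ t]) (simp_all add: eq)
  show "set_integrable lborel A f \<longleftrightarrow> set_integrable lborel B (\<lambda>x. f (t + c * x))"
    unfolding set_integrable_def using assms(1)
    by (subst lborel_integrable_real_affine_iff[of c _ t, symmetric]) (simp_all add: eq)
qed

section \<open>Absolutely continuous functions along a line\<close>

text \<open>Absolute continuity in integrated form, with \<open>f\<close> as the density. Weak
  solutions are given by integral equations, so this form avoids any appeal to differentiation
  almost everywhere.\<close>

definition ac_on :: "real \<Rightarrow> real \<Rightarrow> (real \<Rightarrow> real) \<Rightarrow> (real \<Rightarrow> real) \<Rightarrow> bool" where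
  "ac_on a b F f \<longleftrightarrow> set_integrable lborel {a..b} f \<and>
     (\<forall>r\<in>{a..b}. F r = F a + (LBINT q:{a..r}. f q))"

lemma ac_onD:
  assumes "ac_on a b F f"
  shows "set_integrable lborel {a..b} f"
    and "r \<in> {a..b} \<Longrightarrow> F r = F a + (LBINT q:{a..r}. f q)"
  using assms unfolding ac_on_def by blast+

lemma ac_onI:
  assumes "\<And>r. a \<le> r \<Longrightarrow> r \<le> b \<Longrightarrow> set_integrable lborel {a..r} f \<and> F r = F a + (LBINT q:{a..r}. f q)"
    and "a \<le> b"
  shows "ac_on a b F f"
  unfolding ac_on_def by (metis assms atLeastAtMost_iff order_refl)

lemma integrable_pair_mult:
  fixes f g :: "real \<Rightarrow> real"
  assumes "integrable lborel f" "integrable lborel g"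
  shows "integrable (lborel \<Otimes>\<^sub>M lborel) (\<lambda>p. f (fst p) * g (snd p))"
proof (rule lborel_pair.Fubini_integrable)
  have [measurable]: "f \<in> borel_measurable borel" "g \<in> borel_measurable borel"
    using assms by (simp_all add: integrable_iff_bounded)
  show "(\<lambda>p. f (fst p) * g (snd p)) \<in> borel_measurable (lborel \<Otimes>\<^sub>M lborel)"
    by measurable
  show "integrable lborel (\<lambda>x. \<integral>y. norm (f (fst (x, y)) * g (snd (x, y))) \<partial>lborel)"
    using assms by (simp add: abs_mult)
  show "AE x in lborel. integrable lborel (\<lambda>y. f (fst (x, y)) * g (snd (x, y)))"
    using assms by simp
qed

text \<open>The product rule by Fubini: \<open>(F b - F a) * (G b - G a)\<close> is the integral of
  \<open>f x * g y\<close> over a square. Cutting the square along its diagonal and integrating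
  first over the inner variable gives \<open>f * (G - G a)\<close> from one half and
  \<open>(F - F a) * g\<close> from the other.\<close>

lemma ac_on_product:
  assumes ab: "a \<le> b" and F: "ac_on a b F f" and G: "ac_on a b G g"
  shows "(LBINT r:{a..b}. f r * G r + F r * g r) = F b * G b - F a * G a"
proof -
  define f' where "f' = (\<lambda>r. indicator {a..b} r * f r)"
  define g' where "g' = (\<lambda>r. indicator {a..b} r * g r)"
  have f': "integrable lborel f'" and g': "integrable lborel g'"
    using ac_onD(1)[OF F] ac_onD(1)[OF G] by (simp_all add: set_integrable_def f'_def g'_def)
  then have [measurable]: "f' \<in> borel_measurable borel" "g' \<in> borel_measurable borel"
    by (simp_all add: integrable_iff_bounded)
  define h where "h = (\<lambda>p. f' (fst p) * g' (snd p))"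
  define h1 where "h1 = (\<lambda>p. if snd p \<le> fst p then h p else 0)"
  define h2 where "h2 = (\<lambda>p. if fst p < snd p then h p else 0)"
  have h: "integrable (lborel \<Otimes>\<^sub>M lborel) h"
    unfolding h_def by (rule integrable_pair_mult[OF f' g'])
  have [measurable]: "h \<in> borel_measurable (borel \<Otimes>\<^sub>M borel)"
    unfolding h_def by measurable
  have h1: "integrable (lborel \<Otimes>\<^sub>M lborel) h1" and h2: "integrable (lborel \<Otimes>\<^sub>M lborel) h2"
    by (rule Bochner_Integration.integrable_bound[OF h], (simp add: h1_def h2_def), simp add: h1_def h2_def)+
  have IF: "F r = F a + (\<integral>x. (if x \<le> r then f' x else 0) \<partial>lborel)" if "r \<in> {a..b}" for r
  proof -
    have "(LBINT q:{a..r}. f q) = (\<integral>x. (if x \<le> r then f' x else 0) \<partial>lborel)"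
      unfolding set_lebesgue_integral_def
      by (rule Bochner_Integration.integral_cong) (use that in \<open>auto simp: f'_def indicator_def\<close>)
    then show ?thesis using ac_onD(2)[OF F that] by simp
  qed
  have IG: "G r = G a + (\<integral>x. (if x \<le> r then g' x else 0) \<partial>lborel)" if "r \<in> {a..b}" for r
  proof -
    have "(LBINT q:{a..r}. g q) = (\<integral>x. (if x \<le> r then g' x else 0) \<partial>lborel)"
      unfolding set_lebesgue_integral_def
      by (rule Bochner_Integration.integral_cong) (use that in \<open>auto simp: g'_def indicator_def\<close>)
    then show ?thesis using ac_onD(2)[OF G that] by simp
  qed
  have e1: "(\<integral>y. h1 (x, y) \<partial>lborel) = f' x * (G x - G a)" for x
  proof -
    have "(\<integral>y. h1 (x, y) \<partial>lborel) = (\<integral>y. f' x * (if y \<le> x then g' y else 0) \<partial>lborel)"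
      by (rule Bochner_Integration.integral_cong) (auto simp: h1_def h_def)
    also have "\<dots> = f' x * (\<integral>y. (if y \<le> x then g' y else 0) \<partial>lborel)" by simp
    also have "\<dots> = f' x * (G x - G a)"
      using IG[of x] by (cases "x \<in> {a..b}") (auto simp: f'_def)
    finally show ?thesis .
  qed
  have e2: "(\<integral>x. h2 (x, y) \<partial>lborel) = (F y - F a) * g' y" for y
  proof -
    have "(\<integral>x. h2 (x, y) \<partial>lborel) = (\<integral>x. (if x \<le> y then f' x else 0) * g' y \<partial>lborel)"
    proof (rule integral_cong_AE)
      \<comment> \<open>\<open>h2\<close> leaves out the diagonal, which the formula for
        \<open>F\<close> includes; for fixed \<open>y\<close> the difference is a single
        point.\<close>
      have "AE x in lborel. x \<noteq> y" by (rule AE_lborel_singleton)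
      then show "AE x in lborel. h2 (x, y) = (if x \<le> y then f' x else 0) * g' y"
        by (rule eventually_mono) (auto simp: h2_def h_def)
    qed (simp_all add: h2_def)
    also have "\<dots> = (\<integral>x. (if x \<le> y then f' x else 0) \<partial>lborel) * g' y" by simp
    also have "\<dots> = (F y - F a) * g' y"
      using IF[of y] by (cases "y \<in> {a..b}") (auto simp: g'_def)
    finally show ?thesis .
  qed
  have i1: "integrable lborel (\<lambda>x. f' x * (G x - G a))"
    using lborel_pair.integrable_fst'[OF h1] by (simp add: e1)
  have i2: "integrable lborel (\<lambda>y. (F y - F a) * g' y)"
    using lborel_pair.integrable_snd[of "\<lambda>x y. h2 (x, y)"] h2 by (simp add: e2)
  have I1: "(\<integral>x. f' x * (G x - G a) \<partial>lborel) = integral\<^sup>L (lborel \<Otimes>\<^sub>M lborel) h1"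
    using lborel_pair.integral_fst'[OF h1] by (simp add: e1)
  have I2: "(\<integral>y. (F y - F a) * g' y \<partial>lborel) = integral\<^sup>L (lborel \<Otimes>\<^sub>M lborel) h2"
    using lborel_pair.integral_snd[of "\<lambda>x y. h2 (x, y)"] h2 by (simp add: e2)
  have "h = (\<lambda>p. h1 p + h2 p)" by (auto simp: h1_def h2_def)
  then have "integral\<^sup>L (lborel \<Otimes>\<^sub>M lborel) h
      = integral\<^sup>L (lborel \<Otimes>\<^sub>M lborel) h1 + integral\<^sup>L (lborel \<Otimes>\<^sub>M lborel) h2"
    using Bochner_Integration.integral_add[OF h1 h2] by simp
  moreover have "integral\<^sup>L (lborel \<Otimes>\<^sub>M lborel) h = integral\<^sup>L lborel f' * integral\<^sup>L lborel g'"
    using lborel_pair.integral_fst'[OF h] by (simp add: h_def)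
  moreover have "integral\<^sup>L lborel f' = F b - F a" "integral\<^sup>L lborel g' = G b - G a"
    using ac_onD(2)[OF F, of b] ac_onD(2)[OF G, of b] ab
    by (simp_all add: f'_def g'_def set_lebesgue_integral_def)
  ultimately have I: "(\<integral>x. f' x * (G x - G a) \<partial>lborel) + (\<integral>y. (F y - F a) * g' y \<partial>lborel)
      = (F b - F a) * (G b - G a)" by (simp add: I1 I2)
  have "(LBINT r:{a..b}. f r * G r + F r * g r)
      = (\<integral>x. (f' x * (G x - G a) + (F x - F a) * g' x) + (f' x * G a + F a * g' x) \<partial>lborel)"
    unfolding set_lebesgue_integral_def
    by (rule Bochner_Integration.integral_cong) (auto simp: f'_def g'_def algebra_simps)
  also have "\<dots> = (F b - F a) * (G b - G a) + ((F b - F a) * G a + F a * (G b - G a))"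
    using i1 i2 f' g' I \<open>integral\<^sup>L lborel f' = F b - F a\<close> \<open>integral\<^sup>L lborel g' = G b - G a\<close>
    by simp
  finally show ?thesis by (simp add: algebra_simps)
qed

text \<open>In contrast to \<open>solves_along\<close>, there is no entry point and no prescribed
  value, and \<open>P\<close> is only a label of the line that may lie outside \<open>D\<close>.
  Lines entering through different sides can thus be treated alike.\<close>

definition ac_along ::
  "'a::real_vector set \<Rightarrow> 'a \<Rightarrow> ('a \<Rightarrow> real) \<Rightarrow> ('a \<Rightarrow> real) \<Rightarrow> 'a \<Rightarrow> bool" where
  "ac_along D d f g P \<longleftrightarrow>
     (\<forall>a b. a \<le> b \<longrightarrow> P + a *\<^sub>R d \<in> D \<longrightarrow> P + b *\<^sub>R d \<in> D \<longrightarrow>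
        ac_on a b (\<lambda>r. f (P + r *\<^sub>R d)) (\<lambda>r. g (P + r *\<^sub>R d)))"

lemma ac_alongD:
  assumes "ac_along D d f g P" "a \<le> b" "P + a *\<^sub>R d \<in> D" "P + b *\<^sub>R d \<in> D"
  shows "ac_on a b (\<lambda>r. f (P + r *\<^sub>R d)) (\<lambda>r. g (P + r *\<^sub>R d))"
  using assms by (simp add: ac_along_def)

text \<open>\<open>s0\<close> is the parameter at which the line enters \<open>D\<close>.
  Subtracting the equation at \<open>a\<close> from the one at \<open>r\<close> removes the entry
  point and its value; convexity keeps the points in between inside \<open>D\<close>.\<close>

lemma solves_along_imp_ac_along:
  assumes S: "solves_along D d f g (P + s0 *\<^sub>R d) w" and D: "convex D"
    and s0: "\<And>s. P + s *\<^sub>R d \<in> D \<Longrightarrow> s0 \<le> s"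
  shows "ac_along D d f g P"
  unfolding ac_along_def
proof (intro allI impI)
  fix a b :: real
  assume ab: "a \<le> b" and a: "P + a *\<^sub>R d \<in> D" and b: "P + b *\<^sub>R d \<in> D"
  let ?F = "\<lambda>r. f (P + r *\<^sub>R d)" and ?f = "\<lambda>r. g (P + r *\<^sub>R d)"
  have base: "set_integrable lborel {s0..s} ?f \<and> ?F s = w + (LBINT r:{s0..s}. ?f r)"
    if s: "P + s *\<^sub>R d \<in> D" for s
  proof -
    have e: "P + s0 *\<^sub>R d + r *\<^sub>R d = P + (s0 + r) *\<^sub>R d" for r
      by (simp add: scaleR_add_left algebra_simps)
    have "s0 \<le> s" using s0 s by blast
    then have "set_integrable lborel {0..s - s0} (\<lambda>r. ?f (s0 + r)) \<and>
        ?F s = w + (LBINT r:{0..s - s0}. ?f (s0 + r))"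
      using S s unfolding solves_along_def e by (auto dest!: spec[of _ "s - s0"])
    moreover have "s0 + 1 * x \<in> {s0..s} \<longleftrightarrow> x \<in> {0..s - s0}" for x by auto
    ultimately show ?thesis
      using set_lborel_real_affine[of 1 s0 "{s0..s}" "{0..s - s0}" ?f] by simp
  qed
  show "ac_on a b ?F ?f"
  proof (rule ac_onI)
    fix r assume r: "a \<le> r" "r \<le> b"
    have "P + r *\<^sub>R d \<in> D"
    proof (cases "a = b")
      case False
      then have "a < b" using ab by simp
      define u where "u = (r - a) / (b - a)"
      have u: "0 \<le> u" "u \<le> 1" using r \<open>a < b\<close> by (auto simp: u_def divide_simps)
      have "u * (b - a) = r - a" using \<open>a < b\<close> by (simp add: u_def)
      then have "r = (1 - u) * a + u * b" by (simp add: algebra_simps)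
      then have "P + r *\<^sub>R d = P + ((1 - u) * a + u * b) *\<^sub>R d" by simp
      also have "\<dots> = (1 - u) *\<^sub>R (P + a *\<^sub>R d) + u *\<^sub>R (P + b *\<^sub>R d)"
        by (simp add: algebra_simps)
      finally have "P + r *\<^sub>R d = \<dots>" .
      then show ?thesis using convexD_alt[OF D a b u] by simp
    qed (use r a in simp)
    note B = base[OF this] base[OF a]
    have sa: "s0 \<le> a" using s0 a by blast
    have i: "set_integrable lborel {a..r} ?f"
      by (rule set_integrable_subset[of _ "{s0..r}"]) (use B sa in auto)
    have "(LBINT r:{s0..r}. ?f r) = (LBINT r:{s0..a}. ?f r) + (LBINT r:{a..r}. ?f r)"
    proof -
      have "(LBINT r:{s0..r}. ?f r) = (LBINT r:{s0..a} \<union> {a..r}. ?f r)"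
        using sa r by (simp add: ivl_disj_un_two_touch)
      also have "\<dots> = (LBINT r:{s0..a}. ?f r) + (LBINT r:{a..r}. ?f r)"
      proof (rule set_integral_Un_AE)
        have "AE x in lborel. x \<noteq> a" by (rule AE_lborel_singleton)
        then show "AE x in lborel. \<not> (x \<in> {s0..a} \<and> x \<in> {a..r})"
          by (rule eventually_mono) auto
      qed (use B i in auto)
      finally show ?thesis .
    qed
    then show "set_integrable lborel {a..r} ?f \<and> ?F r = ?F a + (LBINT q:{a..r}. ?f q)"
      using B i by simp
  qed (fact ab)
qed

text \<open>Reversal is needed twice: the kernels with \<open>j < i\<close> are integrated against
  \<open>(\<mu> i, \<mu> j)\<close>, and the characteristics of \<open>v j\<close> run towards
  decreasing position, whereas on the triangle they are followed towards increasing
  position.\<close>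

lemma ac_along_uminus:
  assumes "ac_along D (- d) f g P"
  shows "ac_along D d f (\<lambda>p. - g p) P"
  unfolding ac_along_def
proof (intro allI impI)
  fix a b :: real
  assume ab: "a \<le> b" and a: "P + a *\<^sub>R d \<in> D" and b: "P + b *\<^sub>R d \<in> D"
  have A: "ac_on (- b) (- a) (\<lambda>r. f (P + r *\<^sub>R - d)) (\<lambda>r. g (P + r *\<^sub>R - d))"
    using assms ab a b by (simp add: ac_along_def)
  let ?F = "\<lambda>r. f (P + r *\<^sub>R d)" and ?g = "\<lambda>r. g (P + r *\<^sub>R d)"
  have refl: "(LBINT r:{u..v}. g (P - r *\<^sub>R d)) = (LBINT r:{- v..- u}. ?g r)"
    "set_integrable lborel {u..v} (\<lambda>r. g (P - r *\<^sub>R d)) \<longleftrightarrow> set_integrable lborel {- v..- u} ?g" for u v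
  proof -
    have "0 + - 1 * r \<in> {u..v} \<longleftrightarrow> r \<in> {- v..- u}" for r by auto
    then show "(LBINT r:{u..v}. g (P - r *\<^sub>R d)) = (LBINT r:{- v..- u}. ?g r)"
      "set_integrable lborel {u..v} (\<lambda>r. g (P - r *\<^sub>R d)) \<longleftrightarrow> set_integrable lborel {- v..- u} ?g"
      using set_lborel_real_affine[of "-1" 0 "{u..v}" "{- v..- u}" "\<lambda>r. g (P - r *\<^sub>R d)"]
      by simp_all
  qed
  have gi: "set_integrable lborel {a..b} ?g"
    using ac_onD(1)[OF A] refl(2)[of "- b" "- a"] by simp
  \<comment> \<open>Reversal moves the base point from \<open>a\<close> to \<open>b\<close>;
    combining this with its instance at \<open>a\<close> moves it back.\<close>
  have val: "?F r = ?F b + (LBINT q:{r..b}. ?g q)" if "r \<in> {a..b}" for r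
  proof -
    have "f (P + (- r) *\<^sub>R - d) = f (P + (- b) *\<^sub>R - d) + (LBINT q:{- b..- r}. g (P + q *\<^sub>R - d))"
      by (rule ac_onD(2)[OF A]) (use that in auto)
    then show ?thesis using refl(1)[of "- b" "- r"] by simp
  qed
  show "ac_on a b ?F (\<lambda>r. - ?g r)"
    unfolding ac_on_def
  proof (intro conjI ballI)
    show "set_integrable lborel {a..b} (\<lambda>r. - ?g r)"
      using gi by (simp add: set_integrable_def)
    fix r assume r: "r \<in> {a..b}"
    have s: "set_integrable lborel {a..r} ?g" "set_integrable lborel {r..b} ?g"
      by (rule set_integrable_subset[OF gi]; use r in auto)+
    have "(LBINT r:{a..b}. ?g r) = (LBINT r:{a..r} \<union> {r..b}. ?g r)"
      using r by (simp add: ivl_disj_un_two_touch)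
    also have "\<dots> = (LBINT r:{a..r}. ?g r) + (LBINT r:{r..b}. ?g r)"
    proof (rule set_integral_Un_AE)
      have "AE x in lborel. x \<noteq> r" by (rule AE_lborel_singleton)
      then show "AE x in lborel. \<not> (x \<in> {a..r} \<and> x \<in> {r..b})"
        by (rule eventually_mono) auto
    qed (use s in auto)
    finally show "?F r = ?F a + (LBINT q:{a..r}. - ?g q)"
      using val[OF r] val[of a] ab s by (simp add: set_integral_uminus)
  qed
qed

section \<open>Flux through the boundary of the triangle\<close>

text \<open>The line through \<open>(x, 0)\<close> can meet the boundary on \<xi> = 0 at
  \<open>(x, 0)\<close>, on the side at 1 at height \<open>\<beta> / \<alpha> * (1 - x)\<close>, and
  on the diagonal at \<open>\<beta> / (\<beta> - \<alpha>) * x\<close>. The indicators select the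
  two of these points that bound the segment inside the triangle. Through the diagonal the line
  leaves if \<open>\<alpha> < \<beta>\<close> and enters if \<open>\<beta> < \<alpha>\<close>, which
  is the sign; it is parallel to it if they are equal. The three excluded values of \<open>x\<close>
  give the lines through the vertices.\<close>

lemma triangle_line_flux:
  fixes P D :: "real \<times> real \<Rightarrow> real"
  assumes pos: "0 < \<alpha>" "0 < \<beta>" and x: "x \<noteq> 0" "x \<noteq> 1" "x \<noteq> 1 - \<alpha> / \<beta>"
    and ftc: "\<And>a b. x < 1 \<Longrightarrow> a \<le> b \<Longrightarrow> (x + \<alpha> * a, \<beta> * a) \<in> triangle \<Longrightarrow> (x + \<alpha> * b, \<beta> * b) \<in> triangle \<Longrightarrow>
        (LBINT r:{a..b}. D (x + \<alpha> * r, \<beta> * r)) = P (x + \<alpha> * b, \<beta> * b) - P (x + \<alpha> * a, \<beta> * a)"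
  shows "(LBINT r. indicator triangle (x + \<alpha> * r, \<beta> * r) * D (x + \<alpha> * r, \<beta> * r)) =
      indicator {0<..<1} (\<beta> / \<alpha> + - (\<beta> / \<alpha>) * x) * P (1, \<beta> / \<alpha> + - (\<beta> / \<alpha>) * x)
      - indicator {0<..<1} x * P (x, 0)
      + sgn (\<beta> - \<alpha>) * (indicator {0<..<1} (0 + \<beta> / (\<beta> - \<alpha>) * x)
          * P (0 + \<beta> / (\<beta> - \<alpha>) * x, 0 + \<beta> / (\<beta> - \<alpha>) * x))"
    (is "?I = ?R")
proof -
  define e where "e = \<beta> / \<alpha> + - (\<beta> / \<alpha>) * x"
  define y where "y = 0 + \<beta> / (\<beta> - \<alpha>) * x"
  have R: "?R = indicator {0<..<1} e * P (1, e) - indicator {0<..<1} x * P (x, 0)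
      + sgn (\<beta> - \<alpha>) * (indicator {0<..<1} y * P (y, y))"
    unfolding e_def y_def ..
  have e1: "e < 1 \<longleftrightarrow> 1 - \<alpha> / \<beta> < x" "1 < e \<longleftrightarrow> x < 1 - \<alpha> / \<beta>" "0 < e \<longleftrightarrow> x < 1"
    using pos by (auto simp: e_def field_simps)
  have seg: "?I = P (x + \<alpha> * b, \<beta> * b) - P (x + \<alpha> * a, \<beta> * a)"
    if "x < 1" "a \<le> b" "\<And>r. (x + \<alpha> * r, \<beta> * r) \<in> triangle \<longleftrightarrow> a \<le> r \<and> r \<le> b" for a b
  proof -
    have "?I = (LBINT r:{a..b}. D (x + \<alpha> * r, \<beta> * r))"
      unfolding set_lebesgue_integral_def
      by (rule Bochner_Integration.integral_cong) (auto simp: indicator_def that(3))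
    also have "\<dots> = P (x + \<alpha> * b, \<beta> * b) - P (x + \<alpha> * a, \<beta> * a)"
      by (rule ftc) (use that in auto)
    finally show ?thesis .
  qed
  have empty: "?I = 0" if "\<And>r. (x + \<alpha> * r, \<beta> * r) \<notin> triangle"
    using that by simp
  \<comment> \<open>The three constraints are the sides: \<xi> = 0, the diagonal, and the side at
    1.\<close>
  have T: "(x + \<alpha> * r, \<beta> * r) \<in> triangle \<longleftrightarrow> 0 \<le> r \<and> (\<beta> - \<alpha>) * r \<le> x \<and> r \<le> (1 - x) / \<alpha>" for r
    using pos by (auto simp: triangle_def zero_le_mult_iff pos_le_divide_eq algebra_simps)
  have exit: "x + \<alpha> * ((1 - x) / \<alpha>) = 1" "\<beta> * ((1 - x) / \<alpha>) = e"
    using pos by (auto simp: e_def field_simps)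
  consider "x > 1" | "\<alpha> = \<beta>" "x < 1" | "\<beta> < \<alpha>" "x < 1" | "\<alpha> < \<beta>" "x < 1"
    using x by linarith
  then show ?thesis
  proof cases
    case 1
    have "?I = 0"
    proof (rule empty, rule notI)
      fix r assume "(x + \<alpha> * r, \<beta> * r) \<in> triangle"
      then have "0 \<le> r" "r \<le> (1 - x) / \<alpha>" by (auto simp: T)
      moreover have "(1 - x) / \<alpha> < 0" using 1 pos by (simp add: divide_neg_pos)
      ultimately show False by linarith
    qed
    moreover have "\<not> (0 < y \<and> y < 1)" if "\<alpha> \<noteq> \<beta>"
    proof (cases "\<alpha> < \<beta>")
      case True
      have "\<beta> < \<beta> * x" using 1 pos by simp
      then have "\<beta> - \<alpha> < \<beta> * x" using pos by linarith
      then have "1 < y" using True by (simp add: y_def pos_less_divide_eq)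
      then show ?thesis by simp
    next
      case False
      have "0 < \<beta> * x" using 1 pos by simp
      then have "y < 0" using False that by (simp add: y_def divide_pos_neg)
      then show ?thesis by simp
    qed
    moreover have "\<not> 0 < e" using 1 e1 by simp
    ultimately show ?thesis
      unfolding R using 1 by (cases "\<alpha> = \<beta>") (auto simp: indicator_def)
  next
    case 2
    have "y = 0" using 2 by (simp add: y_def)
    have "1 - \<alpha> / \<beta> = 0" using 2 pos by simp
    note T' = T[unfolded 2(1)]
    show ?thesis
    proof (cases "0 < x")
      case True
      have "?I = P (x + \<alpha> * ((1 - x) / \<alpha>), \<beta> * ((1 - x) / \<alpha>)) - P (x + \<alpha> * 0, \<beta> * 0)"
        by (rule seg) (use 2 True pos in \<open>auto simp: T'\<close>)
      then show ?thesis
        unfolding R unfolding exit using e1 2 True \<open>y = 0\<close> \<open>1 - \<alpha> / \<beta> = 0\<close> by (simp add: indicator_def)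
    next
      case False
      then have "?I = 0" using x 2 by (intro empty) (auto simp: T')
      then show ?thesis unfolding R using e1 2 False \<open>y = 0\<close> \<open>1 - \<alpha> / \<beta> = 0\<close>
        by (simp add: indicator_def)
    qed
  next
    case 3
    \<comment> \<open>The parameter of the crossing with the diagonal. Here \<xi> grows more slowly
      than the first coordinate, so \<open>d\<close> is a lower bound for the parameters
      inside.\<close>
    define d where "d = x / (\<beta> - \<alpha>)"
    have d: "\<beta> * d = y" "x + \<alpha> * d = y" "(\<beta> - \<alpha>) * d = x"
      using 3 by (auto simp: y_def d_def field_simps)
    have dr: "(\<beta> - \<alpha>) * r \<le> x \<longleftrightarrow> d \<le> r" for r
      using 3 by (auto simp: d_def field_simps)
    have "0 < y \<longleftrightarrow> x < 0" "d < 0 \<longleftrightarrow> 0 < x"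
      using 3 pos by (auto simp: y_def d_def zero_less_divide_iff divide_less_0_iff mult_less_0_iff zero_less_mult_iff)
    moreover have "y < 1 \<longleftrightarrow> 1 - \<alpha> / \<beta> < x"
      using 3 pos by (auto simp: y_def field_simps)
    ultimately have y1: "0 < y \<longleftrightarrow> x < 0" "y < 1 \<longleftrightarrow> 1 - \<alpha> / \<beta> < x" "d < 0 \<longleftrightarrow> 0 < x"
      by auto
    have dle: "d \<le> (1 - x) / \<alpha> \<longleftrightarrow> y \<le> 1"
      using pos d by (auto simp: pos_le_divide_eq algebra_simps)
    have "y \<noteq> 1" using 3 pos x(3) by (auto simp: y_def field_simps)
    have s: "sgn (\<beta> - \<alpha>) = -1" using 3 by simp
    consider "0 < x" | "x < 0" "1 - \<alpha> / \<beta> < x" | "x < 0" "x < 1 - \<alpha> / \<beta>"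
      using x by linarith
    then show ?thesis
    proof cases
      case 1
      have "?I = P (x + \<alpha> * ((1 - x) / \<alpha>), \<beta> * ((1 - x) / \<alpha>)) - P (x + \<alpha> * 0, \<beta> * 0)"
        by (rule seg) (use 1 3 pos y1 in \<open>auto simp: T dr\<close>)
      moreover have "1 - \<alpha> / \<beta> < x"
      proof -
        have "1 < \<alpha> / \<beta>" using 3 pos by simp
        then show ?thesis using 1 by linarith
      qed
      ultimately show ?thesis
        unfolding R unfolding exit s using e1 1 3 y1 by (simp add: indicator_def)
    next
      case 2
      have "?I = P (x + \<alpha> * ((1 - x) / \<alpha>), \<beta> * ((1 - x) / \<alpha>)) - P (x + \<alpha> * d, \<beta> * d)"
        by (rule seg) (use 2 3 pos y1 dle in \<open>auto simp: T dr\<close>)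
      then show ?thesis
        unfolding R unfolding exit s d(1,2) using e1 2 3 y1 by (simp add: indicator_def)
    next
      case 3
      have "?I = 0" by (rule empty) (use 3 y1 dle x \<open>y \<noteq> 1\<close> in \<open>auto simp: T dr\<close>)
      then show ?thesis
        unfolding R unfolding s using e1 3 y1 by (simp add: indicator_def)
    qed
  next
    case 4
    \<comment> \<open>The same crossing, but now \<xi> grows faster, so \<open>d\<close> is an upper
      bound.\<close>
    define d where "d = x / (\<beta> - \<alpha>)"
    have d: "\<beta> * d = y" "x + \<alpha> * d = y" "(\<beta> - \<alpha>) * d = x"
      using 4 by (auto simp: y_def d_def field_simps)
    have dr: "(\<beta> - \<alpha>) * r \<le> x \<longleftrightarrow> r \<le> d" for r
      using 4 by (auto simp: d_def field_simps)
    have "0 < y \<longleftrightarrow> 0 < x" "d < 0 \<longleftrightarrow> x < 0"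
      using 4 pos by (auto simp: y_def d_def zero_less_divide_iff divide_less_0_iff mult_less_0_iff zero_less_mult_iff)
    moreover have "y < 1 \<longleftrightarrow> x < 1 - \<alpha> / \<beta>"
      using 4 pos by (auto simp: y_def field_simps)
    ultimately have y1: "0 < y \<longleftrightarrow> 0 < x" "y < 1 \<longleftrightarrow> x < 1 - \<alpha> / \<beta>" "d < 0 \<longleftrightarrow> x < 0"
      by auto
    have dle: "d \<le> (1 - x) / \<alpha> \<longleftrightarrow> y \<le> 1" "(1 - x) / \<alpha> \<le> d \<longleftrightarrow> 1 \<le> y"
      using pos d by (auto simp: pos_le_divide_eq pos_divide_le_eq algebra_simps)
    have s: "sgn (\<beta> - \<alpha>) = 1" using 4 by simp
    have lt: "1 - \<alpha> / \<beta> > 0" using 4 pos by simp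
    consider "x < 0" | "0 < x" "x < 1 - \<alpha> / \<beta>" | "0 < x" "1 - \<alpha> / \<beta> < x"
      using x by linarith
    then show ?thesis
    proof cases
      case 1
      have "?I = 0" by (rule empty) (use 1 y1 in \<open>auto simp: T dr\<close>)
      then show ?thesis
        unfolding R unfolding s using e1 1 lt y1 by (simp add: indicator_def)
    next
      case 2
      have "?I = P (x + \<alpha> * d, \<beta> * d) - P (x + \<alpha> * 0, \<beta> * 0)"
        by (rule seg) (use 2 4 pos y1 dle in \<open>auto simp: T dr\<close>)
      then show ?thesis
        unfolding R unfolding s d(1,2) using e1 2 4 y1 by (simp add: indicator_def)
    next
      case 3
      have "?I = P (x + \<alpha> * ((1 - x) / \<alpha>), \<beta> * ((1 - x) / \<alpha>)) - P (x + \<alpha> * 0, \<beta> * 0)"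
        by (rule seg) (use 3 4 pos y1 dle in \<open>auto simp: T dr\<close>)
      then show ?thesis
        unfolding R unfolding exit s using e1 3 4 y1 by (simp add: indicator_def)
    qed
  qed
qed

text \<open>The divergence theorem for the field \<open>(\<alpha> * P, \<beta> * P)\<close>, with
  \<open>D\<close> as the derivative of \<open>P\<close> in direction
  \<open>(\<alpha>, \<beta>)\<close>; the coefficients are the normal components of this direction
  on the three sides. The functions \<open>p1\<close>, \<open>p0\<close>, \<open>pd\<close> stand in
  for the traces, so that integrability is required of them and only equality almost everywhere of
  \<open>P\<close>.\<close>

lemma triangle_flux:
  fixes P D :: "real \<times> real \<Rightarrow> real"
  assumes pos: "0 < \<alpha>" "0 < \<beta>"
    and D: "set_integrable lborel triangle D"
    and ftc: "AE x in lborel. x < 1 \<longrightarrow> (\<forall>a b. a \<le> b \<longrightarrow> (x + \<alpha> * a, \<beta> * a) \<in> triangle \<longrightarrow>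
        (x + \<alpha> * b, \<beta> * b) \<in> triangle \<longrightarrow>
        (LBINT r:{a..b}. D (x + \<alpha> * r, \<beta> * r)) = P (x + \<alpha> * b, \<beta> * b) - P (x + \<alpha> * a, \<beta> * a))"
    and P: "set_integrable lborel {0<..<1} p1"
      "set_integrable lborel {0<..<1} p0"
      "\<alpha> \<noteq> \<beta> \<Longrightarrow> set_integrable lborel {0<..<1} pd"
    and trace: "AE y in lborel. 0 < y \<and> y < 1 \<longrightarrow> P (1, y) = p1 y"
      "AE x in lborel. 0 < x \<and> x < 1 \<longrightarrow> P (x, 0) = p0 x"
      "\<alpha> \<noteq> \<beta> \<Longrightarrow> AE y in lborel. 0 < y \<and> y < 1 \<longrightarrow> P (y, y) = pd y"
  shows "(LBINT p:triangle. D p) = \<alpha> * (LBINT y:{0<..<1}. p1 y)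
      - \<beta> * (LBINT x:{0<..<1}. p0 x) + (\<beta> - \<alpha>) * (LBINT y:{0<..<1}. pd y)"
proof -
  let ?D = "\<lambda>p. indicator triangle p * D p"
  let ?h1 = "\<lambda>y. indicator {0<..<1} y * p1 y"
  let ?h2 = "\<lambda>x. indicator {0<..<1} x * p0 x"
  let ?h3 = "\<lambda>y. indicator {0<..<1} y * pd y"
  let ?G1 = "\<lambda>x. ?h1 (\<beta> / \<alpha> + - (\<beta> / \<alpha>) * x)"
  let ?G3 = "\<lambda>x. sgn (\<beta> - \<alpha>) * ?h3 (0 + \<beta> / (\<beta> - \<alpha>) * x)"
  have ind: "indicator {0<..<1} z * u = indicator {0<..<1} z * w" if "0 < z \<and> z < 1 \<longrightarrow> u = w" for z u w :: real
    using that by (auto simp: indicator_def)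
  have D': "integrable lborel ?D" using D by (simp add: set_integrable_def)
  have s: "shear_map 1 \<alpha> 0 \<beta> 0 (x, r) = (x + \<alpha> * r, \<beta> * r)" for x r
    by (simp add: shear_map_def)
  have Ds: "integrable (lborel \<Otimes>\<^sub>M lborel) (\<lambda>p. ?D (shear_map 1 \<alpha> 0 \<beta> 0 p))"
    unfolding lborel_prod by (rule integrable_shear[OF _ _ D']) (use pos in auto)
  have "(LBINT p:triangle. D p) = \<bar>1 * \<beta>\<bar> * (\<integral>p. ?D (shear_map 1 \<alpha> 0 \<beta> 0 p) \<partial>lborel)"
    unfolding set_lebesgue_integral_def real_scaleR_def
    by (rule integral_shear[OF _ _ D']) (use pos in auto)
  also have "(\<integral>p. ?D (shear_map 1 \<alpha> 0 \<beta> 0 p) \<partial>lborel)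
      = (\<integral>x. \<integral>r. ?D (shear_map 1 \<alpha> 0 \<beta> 0 (x, r)) \<partial>lborel \<partial>lborel)"
    using lborel_pair.integral_fst'[OF Ds] by (simp only: lborel_prod)
  also have "\<dots> = (\<integral>x. ?G1 x - ?h2 x + ?G3 x \<partial>lborel)"
  proof (rule integral_cong_AE)
    show "(\<lambda>x. \<integral>r. ?D (shear_map 1 \<alpha> 0 \<beta> 0 (x, r)) \<partial>lborel) \<in> borel_measurable lborel"
      using lborel_pair.integrable_fst'[OF Ds] by (rule borel_measurable_integrable)
    have [measurable]: "?h1 \<in> borel_measurable borel" "?h2 \<in> borel_measurable borel"
      using P by (simp_all add: set_integrable_def integrable_iff_bounded)
    have "(\<lambda>x. sgn (\<beta> - \<alpha>) * ?h3 (0 + \<beta> / (\<beta> - \<alpha>) * x)) \<in> borel_measurable borel"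
    proof (cases "\<alpha> = \<beta>")
      case False
      then have [measurable]: "?h3 \<in> borel_measurable borel"
        using P by (simp add: set_integrable_def integrable_iff_bounded)
      show ?thesis by measurable
    qed simp
    then show "(\<lambda>x. ?G1 x - ?h2 x + ?G3 x) \<in> borel_measurable lborel"
      by measurable
    have "AE x in lborel. x \<noteq> 0" "AE x in lborel. x \<noteq> 1" "AE x in lborel. x \<noteq> 1 - \<alpha> / \<beta>"
      by (rule AE_lborel_singleton)+
    moreover have "AE x in lborel. 0 < \<beta> / \<alpha> + - (\<beta> / \<alpha>) * x \<and> \<beta> / \<alpha> + - (\<beta> / \<alpha>) * x < 1 \<longrightarrow>
        P (1, \<beta> / \<alpha> + - (\<beta> / \<alpha>) * x) = p1 (\<beta> / \<alpha> + - (\<beta> / \<alpha>) * x)"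
      by (rule AE_lborel_real_affine[OF trace(1)]) (use pos in auto)
    moreover have "AE x in lborel. \<alpha> \<noteq> \<beta> \<longrightarrow> 0 < 0 + \<beta> / (\<beta> - \<alpha>) * x \<and> 0 + \<beta> / (\<beta> - \<alpha>) * x < 1 \<longrightarrow>
        P (0 + \<beta> / (\<beta> - \<alpha>) * x, 0 + \<beta> / (\<beta> - \<alpha>) * x) = pd (0 + \<beta> / (\<beta> - \<alpha>) * x)"
    proof (cases "\<alpha> = \<beta>")
      case False
      have "AE x in lborel. 0 < 0 + \<beta> / (\<beta> - \<alpha>) * x \<and> 0 + \<beta> / (\<beta> - \<alpha>) * x < 1 \<longrightarrow>
        P (0 + \<beta> / (\<beta> - \<alpha>) * x, 0 + \<beta> / (\<beta> - \<alpha>) * x) = pd (0 + \<beta> / (\<beta> - \<alpha>) * x)"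
        by (rule AE_lborel_real_affine[OF trace(3)[OF False]]) (use pos False in auto)
      then show ?thesis by (rule eventually_mono) simp
    qed simp
    ultimately show "AE x in lborel. (\<integral>r. ?D (shear_map 1 \<alpha> 0 \<beta> 0 (x, r)) \<partial>lborel) = ?G1 x - ?h2 x + ?G3 x"
      using ftc trace(2)
    proof eventually_elim
      case (elim x)
      have "(\<integral>r. ?D (shear_map 1 \<alpha> 0 \<beta> 0 (x, r)) \<partial>lborel) =
          indicator {0<..<1} (\<beta> / \<alpha> + - (\<beta> / \<alpha>) * x) * P (1, \<beta> / \<alpha> + - (\<beta> / \<alpha>) * x)
          - indicator {0<..<1} x * P (x, 0)
          + sgn (\<beta> - \<alpha>) * (indicator {0<..<1} (0 + \<beta> / (\<beta> - \<alpha>) * x)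
              * P (0 + \<beta> / (\<beta> - \<alpha>) * x, 0 + \<beta> / (\<beta> - \<alpha>) * x))"
        unfolding s by (rule triangle_line_flux[OF pos]) (use elim in auto)
      also have "indicator {0<..<1} (\<beta> / \<alpha> + - (\<beta> / \<alpha>) * x) * P (1, \<beta> / \<alpha> + - (\<beta> / \<alpha>) * x) = ?G1 x"
        by (rule ind[OF elim(4)])
      also have "indicator {0<..<1} x * P (x, 0) = ?h2 x"
        by (rule ind[OF elim(7)])
      also have "sgn (\<beta> - \<alpha>) * (indicator {0<..<1} (0 + \<beta> / (\<beta> - \<alpha>) * x)
          * P (0 + \<beta> / (\<beta> - \<alpha>) * x, 0 + \<beta> / (\<beta> - \<alpha>) * x)) = ?G3 x"
      proof (cases "\<alpha> = \<beta>")
        case False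
        then show ?thesis
          using ind[OF mp[OF elim(5) False]] by (simp only:)
      qed simp
      finally show ?case .
    qed
  qed
  also have "\<dots> = (\<integral>x. ?G1 x \<partial>lborel) - (\<integral>x. ?h2 x \<partial>lborel) + (\<integral>x. ?G3 x \<partial>lborel)"
  proof -
    have "integrable lborel ?G1"
      using P(1) pos by (intro lborel_integrable_real_affine) (auto simp: set_integrable_def)
    moreover have "integrable lborel ?h2" using P(2) by (simp add: set_integrable_def)
    moreover have "integrable lborel ?G3"
    proof (cases "\<alpha> = \<beta>")
      case False
      then show ?thesis
        using P(3) pos
        by (intro integrable_mult_right lborel_integrable_real_affine) (auto simp: set_integrable_def)
    qed simp
    ultimately show ?thesis by simp
  qed
  \<comment> \<open>So far all sides are parametrized by the intercept \<open>x\<close>. Passing to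
    the position on each side brings in the slopes \<open>\<alpha> / \<beta>\<close> and
    \<open>(\<beta> - \<alpha>) / \<beta>\<close>; the Jacobian \<open>\<beta>\<close> in front then
    yields the stated coefficients.\<close>
  also have "(\<integral>x. ?G1 x \<partial>lborel) = \<alpha> / \<beta> * (LBINT y:{0<..<1}. p1 y)"
    using pos lborel_integral_real_affine[of "- (\<beta> / \<alpha>)" ?h1 "\<beta> / \<alpha>"]
    by (simp add: set_lebesgue_integral_def)
  also have "(\<integral>x. ?G3 x \<partial>lborel) = (\<beta> - \<alpha>) / \<beta> * (LBINT y:{0<..<1}. pd y)"
  proof (cases "\<alpha> = \<beta>")
    case False
    then have "(LBINT y:{0<..<1}. pd y) = \<bar>\<beta> / (\<beta> - \<alpha>)\<bar> * (\<integral>x. ?h3 (0 + \<beta> / (\<beta> - \<alpha>) * x) \<partial>lborel)"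
      using pos lborel_integral_real_affine[of "\<beta> / (\<beta> - \<alpha>)" ?h3 0]
      by (simp add: set_lebesgue_integral_def)
    moreover have "(\<beta> - \<alpha>) / \<beta> * \<bar>\<beta> / (\<beta> - \<alpha>)\<bar> = sgn (\<beta> - \<alpha>)"
      using pos False by (simp add: sgn_if abs_if field_simps)
    ultimately have "(\<beta> - \<alpha>) / \<beta> * (LBINT y:{0<..<1}. pd y)
        = sgn (\<beta> - \<alpha>) * (\<integral>x. ?h3 (0 + \<beta> / (\<beta> - \<alpha>) * x) \<partial>lborel)"
      by (metis mult.assoc)
    then show ?thesis by (simp only: integral_mult_right_zero)
  qed simp
  also have "(\<integral>x. ?h2 x \<partial>lborel) = (LBINT x:{0<..<1}. p0 x)"
    by (simp add: set_lebesgue_integral_def)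
  also have "\<bar>1 * \<beta>\<bar> * (\<alpha> / \<beta> * a - b + (\<beta> - \<alpha>) / \<beta> * c) = \<alpha> * a - \<beta> * b + (\<beta> - \<alpha>) * c" for a b c
    using pos by (simp add: field_simps)
  finally show ?thesis .
qed

section \<open>Integrability\<close>

lemma L2_on_imp_set_integrable:
  assumes "L2_on S f" "S \<in> sets borel" "emeasure lborel S < \<infinity>"
  shows "set_integrable lborel S f"
proof -
  have "set_integrable lborel S (\<lambda>x. 1 + (f x)\<^sup>2)"
    using assms by (intro set_integral_add) (auto simp: L2_on_def set_integrable_def)
  then show ?thesis
    unfolding set_integrable_def
  proof (rule Bochner_Integration.integrable_bound)
    show "(\<lambda>x. indicat_real S x *\<^sub>R f x) \<in> borel_measurable lborel"
      using assms(1) by (simp add: L2_on_def set_borel_measurable_def)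
    have "\<bar>y\<bar> \<le> 1 + y\<^sup>2" for y :: real
    proof -
      have "0 \<le> (\<bar>y\<bar> - 1)\<^sup>2" by simp
      then have "2 * \<bar>y\<bar> \<le> 1 + y\<^sup>2" by (simp add: power2_eq_square algebra_simps)
      then show ?thesis by linarith
    qed
    then show "AE x in lborel. norm (indicat_real S x *\<^sub>R f x) \<le> norm (indicat_real S x *\<^sub>R (1 + (f x)\<^sup>2))"
      by (auto simp: indicator_def abs_of_nonneg add_nonneg_nonneg)
  qed
qed

lemma set_integrable_Linf_mult:
  assumes "Linf_on S f" "set_integrable lborel S g"
  shows "set_integrable lborel S (\<lambda>x. f x * g x)"
proof -
  obtain C where C: "AE x in lborel. x \<in> S \<longrightarrow> \<bar>f x\<bar> \<le> C"
    using assms(1) by (auto simp: Linf_on_def)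
  have g: "integrable lborel (\<lambda>x. indicator S x * g x)"
    using assms(2) by (simp add: set_integrable_def)
  then have "integrable lborel (\<lambda>x. C * (indicator S x * g x))" by simp
  then show ?thesis
    unfolding set_integrable_def
  proof (rule Bochner_Integration.integrable_bound)
    have "(\<lambda>x. indicator S x * f x) \<in> borel_measurable lborel"
      using assms(1) by (simp add: Linf_on_def set_borel_measurable_def)
    then have "(\<lambda>x. (indicator S x * f x) * (indicator S x * g x)) \<in> borel_measurable lborel"
      using borel_measurable_integrable[OF g] by (rule borel_measurable_times)
    also have "(\<lambda>x. (indicator S x * f x) * (indicator S x * g x)) = (\<lambda>x. indicator S x *\<^sub>R (f x * g x))"
      by (auto simp: indicator_def)
    finally show "(\<lambda>x. indicator S x *\<^sub>R (f x * g x)) \<in> borel_measurable lborel" .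
    show "AE x in lborel. norm (indicat_real S x *\<^sub>R (f x * g x)) \<le> norm (C * (indicat_real S x * g x))"
      using C
    proof eventually_elim
      case (elim x)
      then show ?case
        by (auto simp: indicator_def abs_mult intro!: mult_right_mono)
    qed
  qed
qed

lemma set_integrable_sum:
  fixes f :: "'i \<Rightarrow> 'a \<Rightarrow> real"
  assumes "\<And>i. i \<in> I \<Longrightarrow> set_integrable M A (f i)"
  shows "set_integrable M A (\<lambda>x. \<Sum>i\<in>I. f i x)"
  using assms unfolding set_integrable_def scaleR_sum_right
  by (rule Bochner_Integration.integrable_sum)

lemma set_integral_sum:
  fixes f :: "'i \<Rightarrow> 'a \<Rightarrow> real"
  assumes "\<And>i. i \<in> I \<Longrightarrow> set_integrable M A (f i)"
  shows "(LINT x:A|M. (\<Sum>i\<in>I. f i x)) = (\<Sum>i\<in>I. LINT x:A|M. f i x)"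
  using assms unfolding set_integrable_def set_lebesgue_integral_def scaleR_sum_right
  by (rule Bochner_Integration.integral_sum)

lemma set_integral_open_unit_interval:
  fixes f :: "real \<Rightarrow> real"
  shows "set_integrable lborel {0<..<1} f \<longleftrightarrow> set_integrable lborel {0..1} f"
    and "(LBINT x:{0<..<1}. f x) = (LBINT x:{0..1}. f x)"
  by (rule set_integrable_discrete_difference[of "{0, 1}"], auto)
    (rule set_integral_discrete_difference[of "{0, 1}"], auto)

text \<open>Fubini in sheared coordinates. Two slopes are used: \<open>\<alpha> = 0\<close> gives
  the profile at time \<open>t\<close>, and \<open>c = 1 / \<mu> i\<close>,
  \<open>\<alpha> = - 1 / \<mu> i\<close> gives the characteristic of \<open>v i\<close> leaving
  \<open>(t, 1)\<close>. The conditions on \<open>c\<close> say that the time shift is nonnegative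
  at both ends of the unit interval. Integrability is available on bounded time intervals, hence the
  countable exhaustion by \<open>n\<close>.\<close>

lemma AE_section_integrable:
  fixes f :: "real \<times> real \<Rightarrow> real"
  assumes f: "\<And>T. 0 \<le> T \<Longrightarrow> set_integrable lborel ({0..T} \<times> {0..1}) f" and c: "0 \<le> c" "\<alpha> + c \<ge> 0"
  shows "AE t in lborel. 0 \<le> t \<longrightarrow> set_integrable lborel {0..1} (\<lambda>x. f (c + \<alpha> * x + t, x))"
proof -
  have *: "AE t in lborel. 0 \<le> t \<and> t \<le> real n \<longrightarrow> set_integrable lborel {0..1} (\<lambda>x. f (c + \<alpha> * x + t, x))" for n
  proof -
    define T where "T = c + \<bar>\<alpha>\<bar> + real n"
    let ?h = "\<lambda>p. indicator ({0..T} \<times> {0..1}) p * f p"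
    have "integrable lborel ?h"
      using f[of T] c by (simp add: T_def set_integrable_def)
    then have "integrable (lborel \<Otimes>\<^sub>M lborel) (\<lambda>p. ?h (shear_map 1 \<alpha> c 1 0 p))"
      unfolding lborel_prod by (intro integrable_shear) auto
    then have "AE t in lborel. integrable lborel (\<lambda>x. ?h (shear_map 1 \<alpha> c 1 0 (t, x)))"
      by (rule lborel_pair.AE_integrable_fst')
    then show ?thesis
    proof eventually_elim
      case (elim t)
      show ?case
      proof
        assume t: "0 \<le> t \<and> t \<le> real n"
        have "?h (shear_map 1 \<alpha> c 1 0 (t, x)) = indicator {0..1} x *\<^sub>R f (c + \<alpha> * x + t, x)" for x
        proof (cases "x \<in> {0..1}")
          case True
          have "\<alpha> * x \<le> \<bar>\<alpha>\<bar>" using True mult_left_le[of x "\<bar>\<alpha>\<bar>"] abs_le_D1[of "\<alpha> * x" "\<bar>\<alpha>\<bar> * x"]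
            by (auto simp: abs_mult)
          moreover have "0 \<le> c + \<alpha> * x"
          proof -
            have "c + \<alpha> * x = (1 - x) * c + x * (\<alpha> + c)" by (simp add: algebra_simps)
            then show ?thesis using True c by simp
          qed
          ultimately have "c + \<alpha> * x + t \<in> {0..T}" using t by (auto simp: T_def)
          then show ?thesis using True by (simp add: shear_map_def)
        qed (auto simp: shear_map_def indicator_def)
        then show "set_integrable lborel {0..1} (\<lambda>x. f (c + \<alpha> * x + t, x))"
          using elim by (simp add: set_integrable_def)
      qed
    qed
  qed
  have "AE t in lborel. \<forall>n. 0 \<le> t \<and> t \<le> real n \<longrightarrow> set_integrable lborel {0..1} (\<lambda>x. f (c + \<alpha> * x + t, x))"
    unfolding AE_all_countable using * by blast
  then show ?thesis
    by (rule eventually_mono) (metis real_arch_simple)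
qed

lemma triangle_measurable [measurable]: "triangle \<in> sets borel"
proof -
  have "closed ({p :: real \<times> real. 0 \<le> snd p} \<inter> {p. snd p \<le> fst p} \<inter> {p. fst p \<le> 1})"
    by (intro closed_Int closed_Collect_le continuous_intros)
  also have "{p :: real \<times> real. 0 \<le> snd p} \<inter> {p. snd p \<le> fst p} \<inter> {p. fst p \<le> 1} = triangle"
    by (auto simp: triangle_def)
  finally show ?thesis by (rule borel_closed)
qed

lemma convex_triangle: "convex triangle"
proof (rule convexI)
  fix p q :: "real \<times> real" and u w :: real
  assume p: "p \<in> triangle" "q \<in> triangle" "0 \<le> u" "0 \<le> w" "u + w = 1"
  have "u * snd p + w * snd q \<le> u * fst p + w * fst q"
    using p by (intro add_mono mult_left_mono) (auto simp: triangle_def)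
  moreover have "u * fst p + w * fst q \<le> u * 1 + w * 1"
    using p by (intro add_mono mult_left_mono) (auto simp: triangle_def)
  moreover have "0 \<le> u * snd p + w * snd q"
    using p by (auto simp: triangle_def)
  ultimately show "u *\<^sub>R p + w *\<^sub>R q \<in> triangle"
    using p(5) by (simp add: triangle_def case_prod_beta)
qed

lemma solves_along_start: "solves_along D d f g P w \<Longrightarrow> P \<in> D \<Longrightarrow> f P = w"
proof -
  assume "solves_along D d f g P w" "P \<in> D"
  then have "f P = w + (LBINT r:{0..0}. g (P + r *\<^sub>R d))"
    unfolding solves_along_def by (auto dest: spec[of _ 0])
  moreover have "(LBINT r:{0..0::real}. g (P + r *\<^sub>R d)) = 0"
    using set_integral_discrete_difference[of "{0}" "{0..0}" "{}" lborel "\<lambda>r. g (P + r *\<^sub>R d)"]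
    by (simp add: set_lebesgue_integral_def)
  ultimately show ?thesis by simp
qed

section \<open>The boundary control system\<close>

locale boundary_tracking =
  fixes m :: nat
    and \<mu> :: "nat \<Rightarrow> real"
    and \<sigma> :: "nat \<Rightarrow> nat \<Rightarrow> real"
    and L :: "nat \<Rightarrow> nat \<Rightarrow> real \<times> real \<Rightarrow> real"
    and \<Phi> U v0 :: "nat \<Rightarrow> real \<Rightarrow> real"
    and v :: "nat \<Rightarrow> real \<times> real \<Rightarrow> real"
  assumes mu_less: "\<And>i j. 1 \<le> i \<Longrightarrow> i < j \<Longrightarrow> j \<le> m \<Longrightarrow> \<mu> j < \<mu> i"
    and mu_m: "0 < \<mu> m"
    and sigma_diag: "\<And>j. j \<in> {1..m} \<Longrightarrow> \<sigma> j j = 0"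
    and kernel: "kernel_solution m \<mu> \<sigma> L"
    and Phi_L2: "\<And>i T. i \<in> {1..m} \<Longrightarrow> 0 \<le> T \<Longrightarrow> L2_on {0..T} (\<Phi> i)"
    and weak: "weak_solution m \<mu> \<sigma> v0 U v"
    and control: "\<And>i. i \<in> {1..m} \<Longrightarrow> AE t in lborel. 0 \<le> t \<longrightarrow>
           U i t = \<Phi> i (t + 1 / \<mu> i)
             + (\<Sum>j=1..m. LBINT \<xi>:{0..1}. L i j (1, \<xi>) * v j (t, \<xi>))
             - (\<Sum>j\<in>{1..<i}. LBINT \<xi>:{0..1}.
                  \<mu> j / \<mu> i * L i j (\<xi>, 0) * \<Phi> j (t + (1 - \<xi>) / \<mu> i))"
begin

section \<open>Regularity of the solution along its characteristics\<close>

lemma mu_pos: "i \<in> {1..m} \<Longrightarrow> 0 < \<mu> i"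
  using mu_less[of i m] mu_m by (cases "i = m") force+

lemma v_integrable:
  assumes "j \<in> {1..m}" "0 \<le> T"
  shows "set_integrable lborel ({0..T} \<times> {0..1}) (v j)"
proof (rule L2_on_imp_set_integrable)
  show "L2_on ({0..T} \<times> {0..1}) (v j)"
    using weak assms by (simp add: weak_solution_def)
  have "compact ({0..T} \<times> {0..1::real})" by (intro compact_Times) auto
  then show "({0..T} \<times> {0..1::real}) \<in> sets borel" "emeasure lborel ({0..T} \<times> {0..1::real}) < \<infinity>"
    by (rule borel_compact, rule emeasure_compact_finite)
qed

text \<open>The label \<open>c\<close> is the time at which the characteristic reaches position 0.
  If \<open>c < 1 / \<mu> j\<close> it comes from the initial line, at position
  \<open>\<mu> j * c\<close>; otherwise it comes from the controlled boundary, at time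
  \<open>c - 1 / \<mu> j\<close>.\<close>

lemma v_ac_along:
  assumes j: "j \<in> {1..m}"
  shows "AE c in lborel. 0 < c \<longrightarrow>
    ac_along ({0..} \<times> {0..1}) (-1, \<mu> j) (v j) (\<lambda>p. - (\<Sum>k=1..m. \<sigma> j k * v k p)) (c, 0)"
proof -
  let ?S = "\<lambda>p. \<Sum>k=1..m. \<sigma> j k * v k p"
  let ?sol = "\<lambda>P w. solves_along ({0..} \<times> {0..1}) (1, - \<mu> j) (v j) ?S P w"
  note pos = mu_pos[OF j]
  have cv: "convex ({0..} \<times> {0..1} :: (real \<times> real) set)"
    by (intro convex_Times) auto
  have "AE y in lborel. 0 < y \<and> y < 1 \<longrightarrow> ?sol (0, y) (v0 j y)"
    using weak j by (simp add: weak_solution_def)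
  then have "AE c in lborel. 0 < 0 + \<mu> j * c \<and> 0 + \<mu> j * c < 1 \<longrightarrow>
      ?sol (0, 0 + \<mu> j * c) (v0 j (0 + \<mu> j * c))"
    by (rule AE_lborel_real_affine) (use pos in simp)
  moreover have "AE \<tau> in lborel. 0 < \<tau> \<longrightarrow> ?sol (\<tau>, 1) (U j \<tau>)"
    using weak j by (simp add: weak_solution_def)
  then have "AE c in lborel. 0 < - 1 / \<mu> j + 1 * c \<longrightarrow>
      ?sol (- 1 / \<mu> j + 1 * c, 1) (U j (- 1 / \<mu> j + 1 * c))"
    by (rule AE_lborel_real_affine) simp
  \<comment> \<open>The characteristic from the corner \<open>(0, 1)\<close>, which neither family
    covers.\<close>
  moreover have "AE c in lborel. c \<noteq> 1 / \<mu> j" by (rule AE_lborel_singleton)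
  ultimately show ?thesis
  proof eventually_elim
    case (elim c)
    show ?case
    proof
      assume c: "0 < c"
      have "\<exists>s0 w. ?sol ((c, 0) + s0 *\<^sub>R (1, - \<mu> j)) w \<and>
          (\<forall>s. (c, 0) + s *\<^sub>R (1, - \<mu> j) \<in> {0..} \<times> {0..1} \<longrightarrow> s0 \<le> s)"
      proof (cases "c < 1 / \<mu> j")
        case True
        then have "?sol ((c, 0) + (- c) *\<^sub>R (1, - \<mu> j)) (v0 j (0 + \<mu> j * c))"
          using elim(1) c pos by (simp add: field_simps)
        then show ?thesis
          by (intro exI[of _ "- c"] exI[of _ "v0 j (0 + \<mu> j * c)"] conjI) auto
      next
        case False
        then have "?sol ((c, 0) + (- 1 / \<mu> j) *\<^sub>R (1, - \<mu> j)) (U j (- 1 / \<mu> j + 1 * c))"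
          using elim(2,3) pos by (simp add: field_simps)
        then show ?thesis
          by (intro exI[of _ "- 1 / \<mu> j"] exI[of _ "U j (- 1 / \<mu> j + 1 * c)"] conjI)
            (use pos in \<open>auto simp: field_simps\<close>)
      qed
      then have "ac_along ({0..} \<times> {0..1}) (1, - \<mu> j) (v j) ?S (c, 0)"
        using solves_along_imp_ac_along[OF _ cv] by blast
      then have "ac_along ({0..} \<times> {0..1}) (- (- 1, \<mu> j)) (v j) ?S (c, 0)" by simp
      then show "ac_along ({0..} \<times> {0..1}) (- 1, \<mu> j) (v j) (\<lambda>p. - ?S p) (c, 0)"
        by (rule ac_along_uminus)
    qed
  qed
qed

section \<open>Boundary values of the kernels and regularity along their characteristics\<close>

lemma kernel_Linf:
  assumes "i \<in> {1..m}" "j \<in> {1..m}"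
  shows "Linf_on triangle (L i j)" "Linf_on {0..1} (\<lambda>x. L i j (x, 0))"
    "Linf_on {0..1} (\<lambda>\<xi>. L i j (1, \<xi>))"
  using kernel assms by (simp_all add: kernel_solution_def)

lemma kernel_bottom:
  assumes "i \<in> {1..m}" "j \<in> {1..m}" "i \<le> j"
  shows "AE x in lborel. 0 < x \<and> x < 1 \<longrightarrow> L i j (x, 0) = 0"
proof -
  have "AE y in lborel. 0 < y \<and> y < 1 \<longrightarrow> solves_along triangle (\<mu> i, \<mu> j) (L i j)
               (\<lambda>p. \<Sum>k=1..m. \<sigma> k j * L i k p) (y, 0) 0"
    using kernel assms by (simp add: kernel_solution_def)
  then show ?thesis
    by eventually_elim (auto intro: solves_along_start simp: triangle_def)
qed

lemma kernel_diagonal: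
  assumes "i \<in> {1..m}" "j \<in> {1..m}" "i \<noteq> j"
  shows "AE y in lborel. 0 < y \<and> y < 1 \<longrightarrow> L i j (y, y) = kernel_diag \<mu> \<sigma> i j"
proof -
  have "AE y in lborel. 0 < y \<and> y < 1 \<longrightarrow> (\<exists>d g. solves_along triangle d (L i j) g (y, y) (kernel_diag \<mu> \<sigma> i j))"
  proof (cases "i < j")
    case True
    then have "AE y in lborel. 0 < y \<and> y < 1 \<longrightarrow> solves_along triangle (\<mu> i, \<mu> j) (L i j)
               (\<lambda>p. \<Sum>k=1..m. \<sigma> k j * L i k p) (y, y) (kernel_diag \<mu> \<sigma> i j)"
      using kernel assms by (simp add: kernel_solution_def)
    then show ?thesis by eventually_elim blast
  next
    case False
    then have "AE y in lborel. 0 < y \<and> y < 1 \<longrightarrow> solves_along triangle (- \<mu> i, - \<mu> j) (L i j)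
               (\<lambda>p. - (\<Sum>k=1..m. \<sigma> k j * L i k p)) (y, y) (kernel_diag \<mu> \<sigma> i j)"
      using kernel assms by (simp add: kernel_solution_def)
    then show ?thesis by eventually_elim blast
  qed
  then show ?thesis
    by eventually_elim (auto dest: solves_along_start simp: triangle_def)
qed

text \<open>Lines are labelled by their intercept \<open>x\<close> with \<xi> = 0, which may lie
  outside the triangle. Apart from finitely many labels and null sets, each line either misses the
  triangle or carries prescribed data at one end: on \<xi> = 0 for \<open>i = j\<close>; on \<xi> =
  0 or the diagonal for \<open>i < j\<close>, where it enters; on the diagonal or the side at 1 for
  \<open>j < i\<close>, where it leaves.\<close>

lemma kernel_ac_along:
  assumes i: "i \<in> {1..m}" and j: "j \<in> {1..m}"
  shows "AE x in lborel. ac_along triangle (\<mu> i, \<mu> j) (L i j) (\<lambda>p. \<Sum>k=1..m. \<sigma> k j * L i k p) (x, 0)"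
proof -
  let ?K = "\<lambda>p. \<Sum>k=1..m. \<sigma> k j * L i k p"
  let ?ac = "\<lambda>x. ac_along triangle (\<mu> i, \<mu> j) (L i j) ?K (x, 0)"
  note pos = mu_pos[OF i] mu_pos[OF j]
  have vac: "?ac x" if "\<And>r. 0 \<le> r \<Longrightarrow> \<mu> j * r \<le> x + \<mu> i * r \<Longrightarrow> x + \<mu> i * r \<le> 1 \<Longrightarrow> False" for x
  proof -
    have "(x, 0) + r *\<^sub>R (\<mu> i, \<mu> j) \<notin> triangle" for r
      using that[of r] pos by (auto simp: triangle_def mult.commute zero_le_mult_iff)
    then show ?thesis by (simp add: ac_along_def)
  qed
  have right: "?ac x" if "1 < x" for x
  proof (rule vac)
    fix r assume "0 \<le> r" "x + \<mu> i * r \<le> 1"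
    moreover have "0 \<le> \<mu> i * r" using \<open>0 \<le> r\<close> pos by simp
    ultimately show False using that by linarith
  qed
  have bottom: "AE x in lborel. 0 < x \<and> x < 1 \<longrightarrow> ?ac x" if "i \<le> j"
  proof -
    have "AE y in lborel. 0 < y \<and> y < 1 \<longrightarrow> solves_along triangle (\<mu> i, \<mu> j) (L i j) ?K (y, 0) 0"
      using kernel i j that by (simp add: kernel_solution_def)
    then show ?thesis
    proof eventually_elim
      case (elim x)
      show ?case
      proof
        assume "0 < x \<and> x < 1"
        then have "solves_along triangle (\<mu> i, \<mu> j) (L i j) ?K ((x, 0) + 0 *\<^sub>R (\<mu> i, \<mu> j)) 0"
          using elim by simp
        then show "?ac x"
          by (rule solves_along_imp_ac_along[OF _ convex_triangle])
            (use pos in \<open>auto simp: triangle_def zero_le_mult_iff\<close>)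
      qed
    qed
  qed
  have ne: "AE x in lborel. x \<noteq> 0" "AE x in lborel. x \<noteq> 1" "AE x in lborel. x \<noteq> 1 - \<mu> i / \<mu> j"
    by (rule AE_lborel_singleton)+
  consider "i = j" | "i < j" | "j < i" by linarith
  then show ?thesis
  proof cases
    case 1
    have left: "?ac x" if "x < 0" for x
      by (rule vac) (use that 1 in auto)
    have "AE x in lborel. 0 < x \<and> x < 1 \<longrightarrow> ?ac x" using bottom 1 by simp
    then show ?thesis
      using ne
    proof eventually_elim
      case (elim x)
      then show ?case using left right by (metis linorder_neqE_linordered_idom)
    qed
  next
    case 2
    then have lt: "\<mu> j < \<mu> i" using mu_less i j by simp
    \<comment> \<open>The line through \<open>(x, 0)\<close> crosses the diagonal at
      \<open>(q * x, q * x)\<close>.\<close>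
    define q where "q = \<mu> j / (\<mu> j - \<mu> i)"
    have "q < 0" using lt pos by (simp add: q_def divide_pos_neg)
    have "AE y in lborel. 0 < y \<and> y < 1 \<longrightarrow> solves_along triangle (\<mu> i, \<mu> j) (L i j) ?K (y, y) (kernel_diag \<mu> \<sigma> i j)"
      using kernel i j 2 by (simp add: kernel_solution_def)
    then have "AE x in lborel. 0 < 0 + q * x \<and> 0 + q * x < 1 \<longrightarrow>
        solves_along triangle (\<mu> i, \<mu> j) (L i j) ?K (0 + q * x, 0 + q * x) (kernel_diag \<mu> \<sigma> i j)"
      by (rule AE_lborel_real_affine) (use \<open>q < 0\<close> in simp)
    moreover have "AE x in lborel. 0 < x \<and> x < 1 \<longrightarrow> ?ac x" using bottom 2 by simp
    ultimately show ?thesis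
      using ne
    proof eventually_elim
      case (elim x)
      define s0 where "s0 = x / (\<mu> j - \<mu> i)"
      have s0: "x + s0 * \<mu> i = q * x" "s0 * \<mu> j = q * x" "(\<mu> i - \<mu> j) * s0 = - x"
        using lt by (auto simp: q_def s0_def field_simps)
      have low: "s0 \<le> r" if "\<mu> j * r \<le> x + \<mu> i * r" for r
      proof -
        have "(\<mu> i - \<mu> j) * s0 \<le> (\<mu> i - \<mu> j) * r" using that s0(3) by (simp add: algebra_simps)
        then show ?thesis using lt by simp
      qed
      consider "1 < x" | "0 < x" "x < 1" | "x < 0" "q * x < 1" | "x < 0" "1 < q * x"
      proof -
        have "q * x \<noteq> 1" using elim(5) lt pos by (auto simp: q_def field_simps)
        then show ?thesis using elim(3,4) that by linarith
      qed
      then show ?case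
      proof cases
        case 3
        then have "0 < q * x" using \<open>q < 0\<close> by (simp add: mult_neg_neg)
        then have "solves_along triangle (\<mu> i, \<mu> j) (L i j) ?K ((x, 0) + s0 *\<^sub>R (\<mu> i, \<mu> j)) (kernel_diag \<mu> \<sigma> i j)"
          using elim(1) 3 s0 by simp
        then show ?thesis
          by (rule solves_along_imp_ac_along[OF _ convex_triangle])
            (use low in \<open>auto simp: triangle_def mult.commute\<close>)
      next
        case 4
        show ?thesis
        proof (rule vac)
          fix r assume r: "\<mu> j * r \<le> x + \<mu> i * r" "x + \<mu> i * r \<le> 1"
          have "s0 * \<mu> j \<le> r * \<mu> j" using low[OF r(1)] pos by simp
          then show False using r 4 s0 by (simp add: mult.commute)
        qed
      qed (use elim right in auto)
    qed
  next
    case 3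
    then have lt: "\<mu> i < \<mu> j" using mu_less i j by simp
    \<comment> \<open>The line through \<open>(x, 0)\<close> crosses the diagonal at
      \<open>(q * x, q * x)\<close> and the side at 1 at \<open>(1, e x)\<close>.\<close>
    define q where "q = \<mu> j / (\<mu> j - \<mu> i)"
    define e where "e = (\<lambda>x. \<mu> j / \<mu> i + - (\<mu> j / \<mu> i) * x)"
    have "0 < q" using lt pos by (simp add: q_def)
    let ?sol = "\<lambda>P. solves_along triangle (- \<mu> i, - \<mu> j) (L i j) (\<lambda>p. - ?K p) P (kernel_diag \<mu> \<sigma> i j)"
    have "AE y in lborel. 0 < y \<and> y < 1 \<longrightarrow> ?sol (y, y)"
      using kernel i j 3 by (simp add: kernel_solution_def)
    then have "AE x in lborel. 0 < 0 + q * x \<and> 0 + q * x < 1 \<longrightarrow> ?sol (0 + q * x, 0 + q * x)"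
      by (rule AE_lborel_real_affine) (use \<open>0 < q\<close> in simp)
    moreover have "AE y in lborel. 0 < y \<and> y < 1 \<longrightarrow> ?sol (1, y)"
      using kernel i j 3 by (simp add: kernel_solution_def)
    then have "AE x in lborel. 0 < e x \<and> e x < 1 \<longrightarrow> ?sol (1, e x)"
      unfolding e_def by (rule AE_lborel_real_affine) (use pos in simp)
    ultimately show ?thesis
      using ne
    proof eventually_elim
      case (elim x)
      \<comment> \<open>Data are given at the exit point here. For the reversed direction parameters
        change sign, so the last parameter \<open>- s0\<close> becomes the first one,
        \<open>s0\<close>.\<close>
      have bwd: "?ac x" if "?sol ((x, 0) + s0 *\<^sub>R (- \<mu> i, - \<mu> j))"
        and "\<And>r. 0 \<le> r \<Longrightarrow> \<mu> j * r \<le> x + \<mu> i * r \<Longrightarrow> x + \<mu> i * r \<le> 1 \<Longrightarrow> r \<le> - s0" for s0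
      proof -
        have "ac_along triangle (- \<mu> i, - \<mu> j) (L i j) (\<lambda>p. - ?K p) (x, 0)"
        proof (rule solves_along_imp_ac_along[OF that(1) convex_triangle])
          fix s assume "(x, 0) + s *\<^sub>R (- \<mu> i, - \<mu> j) \<in> triangle"
          then show "s0 \<le> s"
            using that(2)[of "- s"] pos by (auto simp: triangle_def mult.commute mult_le_0_iff)
        qed
        then have "ac_along triangle (- (\<mu> i, \<mu> j)) (L i j) (\<lambda>p. - ?K p) (x, 0)" by simp
        then show ?thesis using ac_along_uminus by fastforce
      qed
      have hit: "(\<mu> j - \<mu> i) * r \<le> x" if "\<mu> j * r \<le> x + \<mu> i * r" for r
        using that by (simp add: algebra_simps)
      have qx: "q * x < 1 \<longleftrightarrow> x < 1 - \<mu> i / \<mu> j"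
        using lt pos by (auto simp: q_def field_simps)
      have ex: "e x < 1 \<longleftrightarrow> 1 - \<mu> i / \<mu> j < x" "0 < e x \<longleftrightarrow> x < 1"
        using pos by (auto simp: e_def field_simps)
      consider "1 < x" | "x < 0" | "0 < x" "q * x < 1" | "0 < x" "x < 1" "e x < 1"
        using elim(3-5) qx ex by linarith
      then show ?case
      proof cases
        case 2
        show ?thesis
        proof (rule vac)
          fix r assume r: "0 \<le> r" "\<mu> j * r \<le> x + \<mu> i * r"
          have "0 \<le> (\<mu> j - \<mu> i) * r" using lt r by simp
          then show False using hit[OF r(2)] 2 by linarith
        qed
      next
        case 3
        let ?s = "- (x / (\<mu> j - \<mu> i))"
        have "(x, 0) + ?s *\<^sub>R (- \<mu> i, - \<mu> j) = (q * x, q * x)"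
          using lt by (auto simp: q_def field_simps)
        then have "?sol ((x, 0) + ?s *\<^sub>R (- \<mu> i, - \<mu> j))"
          using elim(1) 3 \<open>0 < q\<close> by simp
        then show ?thesis
          by (rule bwd) (use lt hit in \<open>auto simp: pos_le_divide_eq mult.commute\<close>)
      next
        case 4
        let ?s = "- ((1 - x) / \<mu> i)"
        have "(x, 0) + ?s *\<^sub>R (- \<mu> i, - \<mu> j) = (1, e x)"
          using pos by (auto simp: e_def field_simps)
        then have "?sol ((x, 0) + ?s *\<^sub>R (- \<mu> i, - \<mu> j))"
          using elim(2) 4 ex by simp
        then show ?thesis
          by (rule bwd) (use pos in \<open>auto simp: pos_le_divide_eq mult.commute algebra_simps\<close>)
      qed (use right in auto)
    qed
  qed
qed

section \<open>Flux balance on the triangle\<close>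

text \<open>The components of \<open>v\<close> with time replaced by the position \<open>x\<close> reached by the characteristic of
  \<open>v i\<close> that leaves \<open>(t, 1)\<close>.\<close>

definition V :: "nat \<Rightarrow> real \<Rightarrow> nat \<Rightarrow> real \<times> real \<Rightarrow> real" where
  "V i t k p = v k (t + (1 - fst p) / \<mu> i, snd p)"

text \<open>The derivative of \<open>L i j * V i t j\<close> in direction \<open>(\<mu> i, \<mu> j)\<close>.\<close>

definition D :: "nat \<Rightarrow> real \<Rightarrow> nat \<Rightarrow> real \<times> real \<Rightarrow> real" where
  "D i t j p = (\<Sum>k=1..m. \<sigma> k j * L i k p) * V i t j p
     + L i j p * - (\<Sum>k=1..m. \<sigma> j k * V i t k p)"

text \<open>For fixed \<open>t\<close> the change from position to time is an invertible affine map
  of the plane that sends the triangle into a bounded part of the strip. Integrability therefore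
  holds for every \<open>t \<ge> 0\<close>, without exceptional times.\<close>

lemma V_integrable:
  assumes i: "i \<in> {1..m}" and k: "k \<in> {1..m}" and t: "0 \<le> t"
  shows "set_integrable lborel triangle (V i t k)"
proof -
  note pos = mu_pos[OF i]
  let ?R = "{0..t + 1 / \<mu> i} \<times> {0..1}"
  let ?h = "\<lambda>p. indicator ?R p * v k p"
  let ?s = "shear_map (- 1 / \<mu> i) 0 (t + 1 / \<mu> i) 1 0"
  have "integrable lborel ?h"
    using v_integrable[OF k, of "t + 1 / \<mu> i"] pos t by (simp add: set_integrable_def)
  then have "integrable lborel (\<lambda>p. ?h (?s p))"
    by (intro integrable_shear) (use pos in auto)
  then have "set_integrable lborel triangle (\<lambda>p. ?h (?s p))"
    unfolding set_integrable_def by (intro integrable_mult_indicator) auto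
  moreover have "?h (?s p) = V i t k p" if "p \<in> triangle" for p
  proof -
    obtain x y where p: "p = (x, y)" by (cases p)
    have xy: "0 \<le> y" "y \<le> x" "x \<le> 1" using that by (auto simp: p triangle_def)
    have s: "?s p = (t + (1 - x) / \<mu> i, y)"
      by (simp add: p shear_map_def diff_divide_distrib)
    have "(1 - x) / \<mu> i \<le> 1 / \<mu> i" "0 \<le> (1 - x) / \<mu> i"
      using xy pos by (auto intro: divide_right_mono)
    then show ?thesis using xy t unfolding s by (simp add: V_def p)
  qed
  ultimately show ?thesis
    by (subst set_integrable_cong[OF refl refl, of _ _ "\<lambda>p. ?h (?s p)"]) auto
qed

lemma D_integrable:
  assumes i: "i \<in> {1..m}" and j: "j \<in> {1..m}" and t: "0 \<le> t"
  shows "set_integrable lborel triangle (D i t j)"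
proof -
  have LV: "set_integrable lborel triangle (\<lambda>p. L i k p * V i t l p)"
    if "k \<in> {1..m}" "l \<in> {1..m}" for k l
    by (rule set_integrable_Linf_mult[OF kernel_Linf(1)[OF i that(1)] V_integrable[OF i that(2) t]])
  have "D i t j = (\<lambda>p. (\<Sum>k=1..m. \<sigma> k j * (L i k p * V i t j p))
      + (\<Sum>k=1..m. - \<sigma> j k * (L i j p * V i t k p)))"
    by (auto simp: D_def sum_distrib_left sum_distrib_right sum_negf mult_ac fun_eq_iff)
  moreover have "set_integrable lborel triangle (\<lambda>p. (\<Sum>k=1..m. \<sigma> k j * (L i k p * V i t j p))
      + (\<Sum>k=1..m. - \<sigma> j k * (L i j p * V i t k p)))"
    using LV j by (intro set_integral_add set_integrable_sum set_integrable_mult_right) auto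
  ultimately show ?thesis by simp
qed

text \<open>The kernel source uses the columns of \<open>\<sigma>\<close> and the source of
  \<open>v\<close> uses the rows; exchanging the two summation indices identifies the double
  sums.\<close>

lemma sum_D: "(\<Sum>j=1..m. D i t j p) = 0"
proof -
  have "(\<Sum>j=1..m. D i t j p) = (\<Sum>j=1..m. \<Sum>k=1..m. \<sigma> k j * L i k p * V i t j p)
      - (\<Sum>j=1..m. \<Sum>k=1..m. \<sigma> j k * L i j p * V i t k p)"
    by (simp add: D_def sum.distrib sum_subtractf sum_distrib_left sum_distrib_right mult_ac)
  also have "(\<Sum>j=1..m. \<Sum>k=1..m. \<sigma> k j * L i k p * V i t j p)
      = (\<Sum>j=1..m. \<Sum>k=1..m. \<sigma> j k * L i j p * V i t k p)"
    by (rule sum.swap)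
  finally show ?thesis by simp
qed

text \<open>Advancing by \<open>r\<close> along \<open>(\<mu> i, \<mu> j)\<close> lowers the time in
  \<open>V\<close> by \<open>r\<close> and raises the position by \<open>\<mu> j * r\<close>: this
  is the characteristic of \<open>v j\<close> with exit time
  \<open>c = t + (1 - x) / \<mu> i\<close>, run backwards. As \<open>c\<close> is affine in
  \<open>x\<close>, for every fixed \<open>t\<close> almost every \<open>x\<close> avoids the bad
  characteristics of both factors, and \<open>x < 1\<close> ensures \<open>c > 0\<close>.\<close>

lemma D_ftc:
  assumes i: "i \<in> {1..m}" and j: "j \<in> {1..m}" and t: "0 \<le> t"
  shows "AE x in lborel. x < 1 \<longrightarrow> (\<forall>a b. a \<le> b \<longrightarrow> (x + \<mu> i * a, \<mu> j * a) \<in> triangle \<longrightarrow>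
      (x + \<mu> i * b, \<mu> j * b) \<in> triangle \<longrightarrow>
      (LBINT r:{a..b}. D i t j (x + \<mu> i * r, \<mu> j * r)) =
        L i j (x + \<mu> i * b, \<mu> j * b) * V i t j (x + \<mu> i * b, \<mu> j * b)
        - L i j (x + \<mu> i * a, \<mu> j * a) * V i t j (x + \<mu> i * a, \<mu> j * a))"
proof -
  note pos = mu_pos[OF i] mu_pos[OF j]
  let ?S = "\<lambda>p. \<Sum>k=1..m. \<sigma> j k * v k p"
  have "AE x in lborel. 0 < (t + 1 / \<mu> i) + (- 1 / \<mu> i) * x \<longrightarrow>
      ac_along ({0..} \<times> {0..1}) (-1, \<mu> j) (v j) (\<lambda>p. - ?S p) ((t + 1 / \<mu> i) + (- 1 / \<mu> i) * x, 0)"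
    by (rule AE_lborel_real_affine[OF v_ac_along[OF j]]) (use pos in auto)
  with kernel_ac_along[OF i j] show ?thesis
  proof eventually_elim
    case (elim x)
    define c where "c = t + (1 - x) / \<mu> i"
    have c: "(t + 1 / \<mu> i) + (- 1 / \<mu> i) * x = c"
      by (simp add: c_def diff_divide_distrib)
    show ?case
    proof (intro impI allI)
      fix a b
      assume x: "x < 1" and ab: "a \<le> b"
        and a: "(x + \<mu> i * a, \<mu> j * a) \<in> triangle" and b: "(x + \<mu> i * b, \<mu> j * b) \<in> triangle"
      have "0 < (1 - x) / \<mu> i" using x pos by simp
      then have "0 < c" using t by (simp add: c_def)
      then have vc: "ac_along ({0..} \<times> {0..1}) (-1, \<mu> j) (v j) (\<lambda>p. - ?S p) (c, 0)"
        using elim(2)[unfolded c] by blast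
      have strip: "(c, 0) + r *\<^sub>R (-1, \<mu> j) \<in> {0..} \<times> {0..1}"
        if "(x + \<mu> i * r, \<mu> j * r) \<in> triangle" for r
      proof -
        have "r * \<mu> i \<le> 1 - x" using that by (simp add: triangle_def mult.commute)
        then have "r \<le> (1 - x) / \<mu> i" using pos by (simp add: pos_le_divide_eq)
        moreover have "0 \<le> \<mu> j * r" "\<mu> j * r \<le> 1" using that by (auto simp: triangle_def)
        ultimately show ?thesis using t by (simp add: c_def mult.commute[of r])
      qed
      have Vc: "V i t k (x + \<mu> i * r, \<mu> j * r) = v k ((c, 0) + r *\<^sub>R (-1, \<mu> j))" for k r
      proof -
        have "t + (1 - (x + \<mu> i * r)) / \<mu> i = c - r"
          using pos by (simp add: c_def field_simps)
        then show ?thesis unfolding V_def by (simp add: mult.commute[of r])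
      qed
      have "ac_on a b (\<lambda>r. v j ((c, 0) + r *\<^sub>R (-1, \<mu> j))) (\<lambda>r. - ?S ((c, 0) + r *\<^sub>R (-1, \<mu> j)))"
        by (rule ac_alongD[OF vc ab strip[OF a] strip[OF b]])
      then have acV: "ac_on a b (\<lambda>r. V i t j (x + \<mu> i * r, \<mu> j * r))
          (\<lambda>r. - (\<Sum>k=1..m. \<sigma> j k * V i t k (x + \<mu> i * r, \<mu> j * r)))"
        by (simp only: Vc)
      have pt: "(x, 0) + r *\<^sub>R (\<mu> i, \<mu> j) = (x + \<mu> i * r, \<mu> j * r)" for r
        by (simp add: mult.commute)
      have acL: "ac_on a b (\<lambda>r. L i j (x + \<mu> i * r, \<mu> j * r))
          (\<lambda>r. \<Sum>k=1..m. \<sigma> k j * L i k (x + \<mu> i * r, \<mu> j * r))"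
        using ac_alongD[OF elim(1) ab] a b unfolding pt by simp
      show "(LBINT r:{a..b}. D i t j (x + \<mu> i * r, \<mu> j * r)) =
        L i j (x + \<mu> i * b, \<mu> j * b) * V i t j (x + \<mu> i * b, \<mu> j * b)
        - L i j (x + \<mu> i * a, \<mu> j * a) * V i t j (x + \<mu> i * a, \<mu> j * a)"
        using ac_on_product[OF ab acL acV] by (simp only: D_def)
    qed
  qed
qed

text \<open>The value of \<open>L i j\<close> on the diagonal is chosen so that \<open>(\<mu> j -
  \<mu> i) * kernel_diag \<mu> \<sigma> i j = \<sigma> i j\<close>: the diagonal flux becomes a
  source term of \<open>v i\<close>. \<open>p0\<close> is left open because it is obtained
  differently for \<open>j < i\<close> and \<open>i \<le> j\<close>.\<close>

lemma D_flux:
  assumes i: "i \<in> {1..m}" and j: "j \<in> {1..m}" and t: "0 \<le> t"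
    and vt: "set_integrable lborel {0..1} (\<lambda>y. v j (t, y))"
    and vd: "set_integrable lborel {0..1} (\<lambda>x. v j (t + (1 - x) / \<mu> i, x))"
    and p0: "set_integrable lborel {0..1} p0"
      "AE x in lborel. 0 < x \<and> x < 1 \<longrightarrow> L i j (x, 0) * v j (t + (1 - x) / \<mu> i, 0) = p0 x"
  shows "(LBINT p:triangle. D i t j p) =
    \<mu> i * (LBINT y:{0..1}. L i j (1, y) * v j (t, y)) - \<mu> j * (LBINT x:{0..1}. p0 x)
    + \<sigma> i j * (LBINT x:{0..1}. v j (t + (1 - x) / \<mu> i, x))"
proof -
  note pos = mu_pos[OF i] mu_pos[OF j]
  have ne: "\<mu> i \<noteq> \<mu> j" if "i \<noteq> j"
    using mu_less[of i j] mu_less[of j i] i j that by (cases "i < j") force+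
  let ?pd = "\<lambda>x. kernel_diag \<mu> \<sigma> i j * v j (t + (1 - x) / \<mu> i, x)"
  have "(LBINT p:triangle. D i t j p) = \<mu> i * (LBINT y:{0<..<1}. L i j (1, y) * v j (t, y))
      - \<mu> j * (LBINT x:{0<..<1}. p0 x) + (\<mu> j - \<mu> i) * (LBINT x:{0<..<1}. ?pd x)"
  proof (rule triangle_flux[where P = "\<lambda>p. L i j p * V i t j p"])
    show "set_integrable lborel triangle (D i t j)" by (rule D_integrable[OF i j t])
    show "set_integrable lborel {0<..<1} (\<lambda>y. L i j (1, y) * v j (t, y))"
      unfolding set_integral_open_unit_interval
      by (rule set_integrable_Linf_mult[OF kernel_Linf(3)[OF i j] vt])
    show "set_integrable lborel {0<..<1} p0" unfolding set_integral_open_unit_interval by (rule p0(1))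
    show "set_integrable lborel {0<..<1} ?pd"
      unfolding set_integral_open_unit_interval using vd by simp
    show "AE y in lborel. 0 < y \<and> y < 1 \<longrightarrow> L i j (1, y) * V i t j (1, y) = L i j (1, y) * v j (t, y)"
      by (simp add: V_def)
    show "AE x in lborel. 0 < x \<and> x < 1 \<longrightarrow> L i j (x, 0) * V i t j (x, 0) = p0 x"
      using p0(2) by (simp add: V_def)
    assume "\<mu> i \<noteq> \<mu> j"
    then have "i \<noteq> j" by auto
    from kernel_diagonal[OF i j this]
    show "AE y in lborel. 0 < y \<and> y < 1 \<longrightarrow> L i j (y, y) * V i t j (y, y) = ?pd y"
      by eventually_elim (simp add: V_def)
  qed (use pos D_ftc[OF i j t] in auto)
  also have "(\<mu> j - \<mu> i) * (LBINT x:{0<..<1}. ?pd x)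
      = \<sigma> i j * (LBINT x:{0..1}. v j (t + (1 - x) / \<mu> i, x))"
  proof -
    have "(\<mu> j - \<mu> i) * kernel_diag \<mu> \<sigma> i j = \<sigma> i j"
    proof (cases "i = j")
      \<comment> \<open>For \<open>i = j\<close> the diagonal is itself a characteristic and carries
        no flux; this matches the source of \<open>v i\<close>, since
        \<open>\<sigma> i i = 0\<close>.\<close>
      case True
      then show ?thesis using sigma_diag[OF i] by simp
    next
      case False
      then show ?thesis using ne by (simp add: kernel_diag_def field_simps)
    qed
    then show ?thesis
      unfolding set_integral_open_unit_interval set_integral_mult_right by (simp flip: mult.assoc)
  qed
  finally show ?thesis by (simp only: set_integral_open_unit_interval)
qed

section \<open>Tracking, one component after another\<close>

text \<open>A characteristic of \<open>v i\<close> launched at \<open>t \<ge> T\<close> arrives at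
  \<open>t + 1 / \<mu> i\<close>. The flux through \<xi> = 0 involves only traces at the times
  \<open>t + (1 - x) / \<mu> i\<close>, all at least \<open>T\<close>, where the lower components
  already equal their references.\<close>

lemma tracking_step:
  assumes i: "i \<in> {1..m}" and T: "0 \<le> T"
    and IH: "\<And>j. j \<in> {1..<i} \<Longrightarrow> AE t in lborel. T \<le> t \<longrightarrow> v j (t, 0) = \<Phi> j t"
  shows "AE t in lborel. T + 1 / \<mu> i \<le> t \<longrightarrow> v i (t, 0) = \<Phi> i t"
proof -
  note pos = mu_pos[OF i]
  have vd_eq: "t + (1 - x) / \<mu> i = 1 / \<mu> i + (- 1 / \<mu> i) * x + t" for t x
    by (simp add: diff_divide_distrib)
  have sec: "AE t in lborel. \<forall>j\<in>{1..m}. 0 \<le> t \<longrightarrow>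
      set_integrable lborel {0..1} (\<lambda>y. v j (t, y)) \<and>
      set_integrable lborel {0..1} (\<lambda>x. v j (t + (1 - x) / \<mu> i, x))"
  proof (rule AE_finite_allI)
    fix j assume j: "j \<in> {1..m}"
    have "AE t in lborel. 0 \<le> t \<longrightarrow> set_integrable lborel {0..1} (\<lambda>x. v j (0 + 0 * x + t, x))"
      by (rule AE_section_integrable) (use v_integrable[OF j] in auto)
    moreover have "AE t in lborel. 0 \<le> t \<longrightarrow>
        set_integrable lborel {0..1} (\<lambda>x. v j (1 / \<mu> i + (- 1 / \<mu> i) * x + t, x))"
      by (rule AE_section_integrable) (use v_integrable[OF j] pos in auto)
    ultimately show "AE t in lborel. 0 \<le> t \<longrightarrow> set_integrable lborel {0..1} (\<lambda>y. v j (t, y)) \<and>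
      set_integrable lborel {0..1} (\<lambda>x. v j (t + (1 - x) / \<mu> i, x))"
      unfolding vd_eq by eventually_elim simp
  qed simp
  have char: "AE \<tau> in lborel. 0 < \<tau> \<longrightarrow>
     solves_along ({0..} \<times> {0..1}) (1, - \<mu> i) (v i) (\<lambda>p. \<Sum>j=1..m. \<sigma> i j * v j p) (\<tau>, 1) (U i \<tau>)"
    using weak i by (simp add: weak_solution_def)
  \<comment> \<open>Boundary characteristics are available for positive launch times only, while
    \<open>T\<close> may be 0.\<close>
  have "AE t in lborel. t \<noteq> 0" by (rule AE_lborel_singleton)
  with sec char control[OF i]
  have "AE t in lborel. T \<le> t \<longrightarrow> v i (t + 1 / \<mu> i, 0) = \<Phi> i (t + 1 / \<mu> i)"
  proof eventually_elim
    case (elim t)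
    show ?case
    proof
      assume "T \<le> t"
      then have t: "0 < t" using elim(4) T by simp
      define A where "A j = (LBINT \<xi>:{0..1}. L i j (1, \<xi>) * v j (t, \<xi>))" for j
      define B where "B j = (LBINT \<xi>:{0..1}. L i j (\<xi>, 0) * \<Phi> j (t + (1 - \<xi>) / \<mu> i))" for j
      define C where "C j = (LBINT x:{0..1}. v j (t + (1 - x) / \<mu> i, x))" for j
      have sections: "set_integrable lborel {0..1} (\<lambda>y. v j (t, y))"
        "set_integrable lborel {0..1} (\<lambda>x. v j (t + (1 - x) / \<mu> i, x))" if "j \<in> {1..m}" for j
        using elim(1) t that by simp_all
      have flux: "(LBINT p:triangle. D i t j p) = \<mu> i * A j - (if j < i then \<mu> j * B j else 0) + \<sigma> i j * C j"
        if j: "j \<in> {1..m}" for j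
      proof (cases "j < i")
        case True
        \<comment> \<open>Replacing the trace of \<open>v j\<close> by \<open>\<Phi> j\<close>
          supplies the integrability on \<xi> = 0.\<close>
        let ?p0 = "\<lambda>x. L i j (x, 0) * \<Phi> j (t + (1 - x) / \<mu> i)"
        have "set_integrable lborel {0..t + 1 / \<mu> i} (\<Phi> j)"
          by (rule L2_on_imp_set_integrable) (use Phi_L2[OF j] t pos in auto)
        then have "set_integrable lborel {t..t + 1 / \<mu> i} (\<Phi> j)"
          by (rule set_integrable_subset) (use t in auto)
        moreover have "(t + 1 / \<mu> i) + (- 1 / \<mu> i) * x \<in> {t..t + 1 / \<mu> i} \<longleftrightarrow> x \<in> {0..1}" for x
        proof -
          have "(t + 1 / \<mu> i) + (- 1 / \<mu> i) * x = t + (1 - x) / \<mu> i"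
            by (simp add: diff_divide_distrib)
          moreover have "0 \<le> (1 - x) / \<mu> i \<longleftrightarrow> x \<le> 1" "(1 - x) / \<mu> i \<le> 1 / \<mu> i \<longleftrightarrow> 0 \<le> x"
            using pos by (auto simp: zero_le_divide_iff divide_le_cancel)
          ultimately show ?thesis by (auto simp only: atLeastAtMost_iff le_add_same_cancel1 add_le_cancel_left)
        qed
        ultimately have "set_integrable lborel {0..1} (\<lambda>x. \<Phi> j ((t + 1 / \<mu> i) + (- 1 / \<mu> i) * x))"
          by (subst set_lborel_real_affine(2)[symmetric]) (use pos in auto)
        then have "set_integrable lborel {0..1} (\<lambda>x. \<Phi> j (t + (1 - x) / \<mu> i))"
          by (simp add: diff_divide_distrib add_diff_eq)
        then have "set_integrable lborel {0..1} ?p0"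
          by (rule set_integrable_Linf_mult[OF kernel_Linf(2)[OF i j]])
        moreover have "AE x in lborel. T \<le> (t + 1 / \<mu> i) + (- 1 / \<mu> i) * x \<longrightarrow>
            v j ((t + 1 / \<mu> i) + (- 1 / \<mu> i) * x, 0) = \<Phi> j ((t + 1 / \<mu> i) + (- 1 / \<mu> i) * x)"
          by (rule AE_lborel_real_affine[OF IH]) (use j True pos in auto)
        then have "AE x in lborel. 0 < x \<and> x < 1 \<longrightarrow>
            L i j (x, 0) * v j (t + (1 - x) / \<mu> i, 0) = ?p0 x"
        proof eventually_elim
          case (elim x)
          have eq: "(t + 1 / \<mu> i) + (- 1 / \<mu> i) * x = t + (1 - x) / \<mu> i"
            by (simp add: diff_divide_distrib)
          have "T \<le> t + (1 - x) / \<mu> i" if "x < 1"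
          proof -
            have "0 \<le> (1 - x) / \<mu> i" using that pos by simp
            then show ?thesis using \<open>T \<le> t\<close> by linarith
          qed
          then show ?case using elim[unfolded eq] by metis
        qed
        ultimately have "(LBINT p:triangle. D i t j p) = \<mu> i * A j - \<mu> j * B j + \<sigma> i j * C j"
          unfolding A_def B_def C_def using sections[OF j] t by (intro D_flux[OF i j]) auto
        then show ?thesis using True by simp
      next
        case False
        have "AE x in lborel. 0 < x \<and> x < 1 \<longrightarrow> L i j (x, 0) * v j (t + (1 - x) / \<mu> i, 0) = 0"
          using kernel_bottom[OF i j] False by (auto elim: eventually_mono)
        then have "(LBINT p:triangle. D i t j p) = \<mu> i * A j - \<mu> j * (LBINT x:{0..1::real}. 0) + \<sigma> i j * C j"
          unfolding A_def C_def using sections[OF j] t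
          by (intro D_flux[OF i j]) (auto simp: set_integrable_def)
        then show ?thesis using False by simp
      qed
      have "0 = (LBINT p:triangle. (\<Sum>j=1..m. D i t j p))"
        by (simp only: sum_D set_lebesgue_integral_zero)
      also have "\<dots> = (\<Sum>j=1..m. LBINT p:triangle. D i t j p)"
        by (rule set_integral_sum) (use D_integrable[OF i] t in auto)
      also have "\<dots> = (\<Sum>j=1..m. \<mu> i * A j - (if j < i then \<mu> j * B j else 0) + \<sigma> i j * C j)"
        by (rule sum.cong) (use flux in auto)
      also have "\<dots> = \<mu> i * (\<Sum>j=1..m. A j) - (\<Sum>j=1..m. if j < i then \<mu> j * B j else 0)
          + (\<Sum>j=1..m. \<sigma> i j * C j)"
        by (simp add: sum.distrib sum_subtractf sum_distrib_left)
      also have "(\<Sum>j=1..m. if j < i then \<mu> j * B j else 0) = (\<Sum>j\<in>{1..<i}. \<mu> j * B j)"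
        by (rule sum.mono_neutral_cong_right) (use i in auto)
      finally have bal: "\<mu> i * (\<Sum>j=1..m. A j) + (\<Sum>j=1..m. \<sigma> i j * C j) = (\<Sum>j\<in>{1..<i}. \<mu> j * B j)"
        by simp
      have sol: "solves_along ({0..} \<times> {0..1}) (1, - \<mu> i) (v i) (\<lambda>p. \<Sum>j=1..m. \<sigma> i j * v j p) (t, 1) (U i t)"
        using elim(2) t by blast
      have "0 \<le> 1 / \<mu> i" "(t, 1) + (1 / \<mu> i) *\<^sub>R (1, - \<mu> i) \<in> {0..} \<times> {0..1}"
        using t pos by simp_all
      from sol[unfolded solves_along_def, rule_format, OF this]
      have "v i ((t, 1) + (1 / \<mu> i) *\<^sub>R (1, - \<mu> i)) = U i t
          + (LBINT r:{0..1 / \<mu> i}. \<Sum>j=1..m. \<sigma> i j * v j ((t, 1) + r *\<^sub>R (1, - \<mu> i)))"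
        by blast
      \<comment> \<open>The substitution \<open>r = (1 - x) / \<mu> i\<close> turns the source
        collected in transit into the diagonal integrals \<open>C j\<close>.\<close>
      also have "(LBINT r:{0..1 / \<mu> i}. \<Sum>j=1..m. \<sigma> i j * v j ((t, 1) + r *\<^sub>R (1, - \<mu> i)))
          = 1 / \<mu> i * (LBINT x:{0..1}. \<Sum>j=1..m. \<sigma> i j * v j (t + (1 - x) / \<mu> i, x))"
      proof -
        have "1 / \<mu> i + (- 1 / \<mu> i) * x = (1 - x) / \<mu> i" for x
          by (simp add: diff_divide_distrib)
        moreover have "0 \<le> (1 - x) / \<mu> i \<longleftrightarrow> x \<le> 1" "(1 - x) / \<mu> i \<le> 1 / \<mu> i \<longleftrightarrow> 0 \<le> x" for x
          using pos by (auto simp: zero_le_divide_iff divide_le_cancel)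
        ultimately have "1 / \<mu> i + (- 1 / \<mu> i) * x \<in> {0..1 / \<mu> i} \<longleftrightarrow> x \<in> {0..1}" for x
          by (auto simp only: atLeastAtMost_iff)
        then have "(LBINT r:{0..1 / \<mu> i}. \<Sum>j=1..m. \<sigma> i j * v j ((t, 1) + r *\<^sub>R (1, - \<mu> i)))
          = \<bar>- 1 / \<mu> i\<bar> * (LBINT x:{0..1}. \<Sum>j=1..m. \<sigma> i j * v j ((t, 1) + (1 / \<mu> i + (- 1 / \<mu> i) * x) *\<^sub>R (1, - \<mu> i)))"
          by (intro set_lborel_real_affine(1)) (use pos in auto)
        moreover have "(t, 1) + (1 / \<mu> i + (- 1 / \<mu> i) * x) *\<^sub>R (1, - \<mu> i) = (t + (1 - x) / \<mu> i, x)" for x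
          using pos by (auto simp: field_simps)
        ultimately show ?thesis using pos by (simp only:) simp
      qed
      also have "(LBINT x:{0..1}. \<Sum>j=1..m. \<sigma> i j * v j (t + (1 - x) / \<mu> i, x)) = (\<Sum>j=1..m. \<sigma> i j * C j)"
        unfolding C_def using sections by (subst set_integral_sum) simp_all
      finally have "v i (t + 1 / \<mu> i, 0) = U i t + 1 / \<mu> i * (\<Sum>j=1..m. \<sigma> i j * C j)"
        using pos by simp
      moreover have "U i t = \<Phi> i (t + 1 / \<mu> i) + (\<Sum>j=1..m. A j) - 1 / \<mu> i * (\<Sum>j\<in>{1..<i}. \<mu> j * B j)"
      proof -
        have Beq: "(LBINT \<xi>:{0..1}. \<mu> j / \<mu> i * L i j (\<xi>, 0) * \<Phi> j (t + (1 - \<xi>) / \<mu> i)) = 1 / \<mu> i * (\<mu> j * B j)" for j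
          unfolding B_def mult.assoc set_integral_mult_right by simp
        show ?thesis using elim(3) t unfolding Beq A_def sum_distrib_left by simp
      qed
      \<comment> \<open>By \<open>bal\<close> divided by \<open>\<mu> i\<close>, the collected
        source is the negative of the two integral terms of the control law, so only the reference
        value remains.\<close>
      ultimately show "v i (t + 1 / \<mu> i, 0) = \<Phi> i (t + 1 / \<mu> i)"
        using pos unfolding bal[symmetric] by (simp add: field_simps)
    qed
  qed
  \<comment> \<open>The estimate so far is indexed by launch time; shifting by the transit time
    indexes it by arrival time.\<close>
  then have "AE t in lborel. T \<le> - 1 / \<mu> i + 1 * t \<longrightarrow>
      v i (- 1 / \<mu> i + 1 * t + 1 / \<mu> i, 0) = \<Phi> i (- 1 / \<mu> i + 1 * t + 1 / \<mu> i)"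
    by (rule AE_lborel_real_affine) simp
  then show ?thesis
    by eventually_elim (simp add: algebra_simps)
qed

text \<open>The step for \<open>i\<close> needs all lower components from one common time on. The
  sum over \<open>k < i\<close> works, since it dominates the waiting time of each of them; it is 0
  for \<open>i = 1\<close>.\<close>

lemma tracking:
  assumes "i \<in> {1..m}"
  shows "AE t in lborel. (\<Sum>j=1..i. 1 / \<mu> j) \<le> t \<longrightarrow> v i (t, 0) = \<Phi> i t"
  using assms
proof (induction i rule: less_induct)
  case (less i)
  have mono: "(\<Sum>k=1..j. 1 / \<mu> k) \<le> (\<Sum>k\<in>{1..<i}. 1 / \<mu> k)" if "j \<in> {1..<i}" for j
    by (rule sum_mono2) (use that less.prems mu_pos in \<open>auto intro: less_imp_le\<close>)
  have "AE t in lborel. (\<Sum>k\<in>{1..<i}. 1 / \<mu> k) + 1 / \<mu> i \<le> t \<longrightarrow> v i (t, 0) = \<Phi> i t"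
  proof (rule tracking_step[OF less.prems])
    show "0 \<le> (\<Sum>k\<in>{1..<i}. 1 / \<mu> k)"
      by (rule sum_nonneg) (use less.prems mu_pos in \<open>auto intro: less_imp_le\<close>)
    fix j assume j: "j \<in> {1..<i}"
    then have "AE t in lborel. (\<Sum>k=1..j. 1 / \<mu> k) \<le> t \<longrightarrow> v j (t, 0) = \<Phi> j t"
      using less by auto
    then show "AE t in lborel. (\<Sum>k\<in>{1..<i}. 1 / \<mu> k) \<le> t \<longrightarrow> v j (t, 0) = \<Phi> j t"
      by eventually_elim (use mono[OF j] in auto)
  qed
  moreover have "(\<Sum>k\<in>{1..<i}. 1 / \<mu> k) + 1 / \<mu> i = (\<Sum>k=1..i. 1 / \<mu> k)"
    using less.prems by (simp flip: atLeastLessThanSuc_atLeastAtMost)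
  ultimately show ?case by simp
qed

end

theorem theoremV1:
  fixes m :: nat
    and \<mu> :: "nat \<Rightarrow> real"
    and \<sigma> :: "nat \<Rightarrow> nat \<Rightarrow> real"
    and L :: "nat \<Rightarrow> nat \<Rightarrow> real \<times> real \<Rightarrow> real"
    and \<Phi> U v0 :: "nat \<Rightarrow> real \<Rightarrow> real"
    and v :: "nat \<Rightarrow> real \<times> real \<Rightarrow> real"
  assumes "1 \<le> m"
    and "\<And>i j. 1 \<le> i \<Longrightarrow> i < j \<Longrightarrow> j \<le> m \<Longrightarrow> \<mu> j < \<mu> i"
    and "0 < \<mu> m"
    and "\<And>j. j \<in> {1..m} \<Longrightarrow> \<sigma> j j = 0"
    and "kernel_solution m \<mu> \<sigma> L"
    and "\<And>i T. i \<in> {1..m} \<Longrightarrow> 0 \<le> T \<Longrightarrow> L2_on {0..T} (\<Phi> i)"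
    and "\<And>i. i \<in> {1..m} \<Longrightarrow> L2_on {0..1} (v0 i)"
    and "weak_solution m \<mu> \<sigma> v0 U v"
    and "\<And>i. i \<in> {1..m} \<Longrightarrow> AE t in lborel. 0 \<le> t \<longrightarrow>
           U i t = \<Phi> i (t + 1 / \<mu> i)
             + (\<Sum>j=1..m. LBINT \<xi>:{0..1}. L i j (1, \<xi>) * v j (t, \<xi>))
             - (\<Sum>j\<in>{1..<i}. LBINT \<xi>:{0..1}.
                  \<mu> j / \<mu> i * L i j (\<xi>, 0) * \<Phi> j (t + (1 - \<xi>) / \<mu> i))"
  shows "AE t in lborel. (\<Sum>j=1..m. 1 / \<mu> j) \<le> t \<longrightarrow> (\<forall>i\<in>{1..m}. v i (t, 0) = \<Phi> i t)"
proof -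
  interpret boundary_tracking m \<mu> \<sigma> L \<Phi> U v0 v
    by (rule boundary_tracking.intro) (fact assms)+
  have "AE t in lborel. \<forall>i\<in>{1..m}. (\<Sum>j=1..m. 1 / \<mu> j) \<le> t \<longrightarrow> v i (t, 0) = \<Phi> i t"
  proof (rule AE_finite_allI)
    fix i assume i: "i \<in> {1..m}"
    have "(\<Sum>j=1..i. 1 / \<mu> j) \<le> (\<Sum>j=1..m. 1 / \<mu> j)"
      by (rule sum_mono2) (use i mu_pos in \<open>auto intro: less_imp_le\<close>)
    note le = this
    from tracking[OF i] show "AE t in lborel. (\<Sum>j=1..m. 1 / \<mu> j) \<le> t \<longrightarrow> v i (t, 0) = \<Phi> i t"
      by eventually_elim (use le in auto)
  qed simp
  then show ?thesis by eventually_elim auto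
qed

end
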